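(* Let $R$ be a $(WSU)_2$ ring. Then the following properties hold: (1) $R$ is a $WU_2$ ring. (2) Assume that each element of $R$ is the square of an element of $R$ (e.g., this holds if $R$ is an integrally closed domain with an algebraically closed field of fractions or is a perfect ring of characteristic $2$). Then $R$ is a $U_2$ ring. If moreover $R$ is an $(SU)_2$ ring, then $R$ is an elementary divisor ring.
   Context: Rings are commutative with identity; $U(R)$ is the group of units. $Um(R^2)$ is the set of pairs generating the unit ideal; $Um(\mathbb{M}_2(R))$ is the set of $2\times2$ matrices whose entries generate the unit ideal. $R$ is an $(SU)_2$ (resp. $(WSU)_2$) ring if for each $A\in\mathbb{M}_2(R)$ (resp. each $A\in Um(\mathbb{M}_2(R))$) there exists $N\in GL_2(R)$ such that $AN$ is symmetric. For $(a,b)\in Um(R^2)$ and $c\in R$ consider the natural product homomorphism $U(R/Rac)\times U(R/Rbc)\to U(R/Rc)$ (product of the two reductions). $R$ is a $U_2$ ring if this homomorphism is surjective for all such $a,b,c$; $R$ is a $WU_2$ ring if for all such $a,b,c$ its image contains $\{x^2\mid x\in U(R/Rc)\}$. $R$ is an elementary divisor ring if for all $m,n\ge 1$ each $m\times n$ matrix over $R$ is equivalent (via multiplication by invertible matrices on the left and right) to a matrix whose off-diagonal entries are $0$ and whose diagonal entries $a_{1,1},\ldots,a_{s,s}$, $s=\min\{m,n\}$, satisfy $a_{i,i}\mid a_{i+1,i+1}$ for $1\le i\le s-1$. *)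

theory Defs
  imports "HOL-Algebra.Algebra" "Jordan_Normal_Form.Matrix"
begin

section \<open>Matrices over a ring with carrier\<close>

text \<open>
  The type \<open>'a mat\<close> and its class-free operations (\<open>dim_row\<close>, \<open>transpose_mat\<close>,
  \<open>elements_mat\<close>, \<dots>) serve only as containers. Multiplication and the identity matrix are
  those of the ring \<open>R\<close>; the class-based operations on \<open>'a mat\<close> are not used.
\<close>

definition ring_mats :: "('a, 'm) ring_scheme \<Rightarrow> nat \<Rightarrow> nat \<Rightarrow> 'a mat set" where
  "ring_mats R m n = {A \<in> carrier_mat m n. elements_mat A \<subseteq> carrier R}"

definition rmat_mult :: "('a, 'm) ring_scheme \<Rightarrow> 'a mat \<Rightarrow> 'a mat \<Rightarrow> 'a mat" where
  "rmat_mult R A B = mat (dim_row A) (dim_col B)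
     (\<lambda>(i, j). \<Oplus>\<^bsub>R\<^esub>k\<in>{..<dim_col A}. A $$ (i, k) \<otimes>\<^bsub>R\<^esub> B $$ (k, j))"

definition rmat_one :: "('a, 'm) ring_scheme \<Rightarrow> nat \<Rightarrow> 'a mat" where
  "rmat_one R n = mat n n (\<lambda>(i, j). if i = j then \<one>\<^bsub>R\<^esub> else \<zero>\<^bsub>R\<^esub>)"

definition GL :: "('a, 'm) ring_scheme \<Rightarrow> nat \<Rightarrow> 'a mat set" where
  "GL R n = {N \<in> ring_mats R n n. \<exists>N' \<in> ring_mats R n n.
     rmat_mult R N N' = rmat_one R n \<and> rmat_mult R N' N = rmat_one R n}"

definition symmetric_mat :: "'a mat \<Rightarrow> bool" where
  "symmetric_mat A \<longleftrightarrow> transpose_mat A = A"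

definition Um_pairs :: "('a, 'm) ring_scheme \<Rightarrow> ('a \<times> 'a) set" where
  "Um_pairs R = {(a, b). a \<in> carrier R \<and> b \<in> carrier R \<and> Idl\<^bsub>R\<^esub> {a, b} = carrier R}"

definition Um_mats2 :: "('a, 'm) ring_scheme \<Rightarrow> 'a mat set" where
  "Um_mats2 R = {A \<in> ring_mats R 2 2. Idl\<^bsub>R\<^esub> (elements_mat A) = carrier R}"


section \<open>Classes of rings\<close>

definition SU2_ring :: "('a, 'm) ring_scheme \<Rightarrow> bool" where
  "SU2_ring R \<longleftrightarrow>
     (\<forall>A \<in> ring_mats R 2 2. \<exists>N \<in> GL R 2. symmetric_mat (rmat_mult R A N))"

definition WSU2_ring :: "('a, 'm) ring_scheme \<Rightarrow> bool" where
  "WSU2_ring R \<longleftrightarrow>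
     (\<forall>A \<in> Um_mats2 R. \<exists>N \<in> GL R 2. symmetric_mat (rmat_mult R A N))"

abbreviation principal_quot :: "('a, 'm) ring_scheme \<Rightarrow> 'a \<Rightarrow> 'a set ring" where
  "principal_quot R a \<equiv> R Quot (PIdl\<^bsub>R\<^esub> a)"

text \<open>
  For ideals \<open>I \<subseteq> J\<close> the reduction \<open>R/I \<rightarrow> R/J\<close> sends the coset \<open>I + x\<close> to \<open>J + x = (I + x) + J\<close>.
\<close>

definition quot_reduction ::
  "('a, 'm) ring_scheme \<Rightarrow> 'a set \<Rightarrow> 'a set \<Rightarrow> 'a set" where
  "quot_reduction R J u = u <+>\<^bsub>R\<^esub> J"

definition unit_product_map ::
  "('a, 'm) ring_scheme \<Rightarrow> 'a \<Rightarrow> 'a set \<times> 'a set \<Rightarrow> 'a set" where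
  "unit_product_map R c = (\<lambda>(u, v).
     quot_reduction R (PIdl\<^bsub>R\<^esub> c) u \<otimes>\<^bsub>principal_quot R c\<^esub> quot_reduction R (PIdl\<^bsub>R\<^esub> c) v)"

definition unit_product_image ::
  "('a, 'm) ring_scheme \<Rightarrow> 'a \<Rightarrow> 'a \<Rightarrow> 'a \<Rightarrow> 'a set set" where
  "unit_product_image R a b c = unit_product_map R c `
     (Units (principal_quot R (a \<otimes>\<^bsub>R\<^esub> c)) \<times> Units (principal_quot R (b \<otimes>\<^bsub>R\<^esub> c)))"

definition U2_ring :: "('a, 'm) ring_scheme \<Rightarrow> bool" where
  "U2_ring R \<longleftrightarrow> (\<forall>(a, b) \<in> Um_pairs R. \<forall>c \<in> carrier R.
     unit_product_image R a b c = Units (principal_quot R c))"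

definition WU2_ring :: "('a, 'm) ring_scheme \<Rightarrow> bool" where
  "WU2_ring R \<longleftrightarrow> (\<forall>(a, b) \<in> Um_pairs R. \<forall>c \<in> carrier R.
     {x [^]\<^bsub>principal_quot R c\<^esub> (2::nat) | x. x \<in> Units (principal_quot R c)}
       \<subseteq> unit_product_image R a b c)"

text \<open>Matrix indices start at \<open>0\<close>.\<close>

definition elementary_divisor_ring :: "('a, 'm) ring_scheme \<Rightarrow> bool" where
  "elementary_divisor_ring R \<longleftrightarrow>
     (\<forall>m \<ge> 1. \<forall>n \<ge> 1. \<forall>A \<in> ring_mats R m n. \<exists>P \<in> GL R m. \<exists>Q \<in> GL R n.
        let D = rmat_mult R (rmat_mult R P A) Q in
          (\<forall>i < m. \<forall>j < n. i \<noteq> j \<longrightarrow> D $$ (i, j) = \<zero>\<^bsub>R\<^esub>) \<and>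
          (\<forall>i. Suc i < min m n \<longrightarrow> D $$ (i, i) divides\<^bsub>R\<^esub> D $$ (Suc i, Suc i)))"

definition all_squares :: "('a, 'm) ring_scheme \<Rightarrow> bool" where
  "all_squares R \<longleftrightarrow> (\<forall>x \<in> carrier R. \<exists>y \<in> carrier R. x = y [^]\<^bsub>R\<^esub> (2::nat))"

text \<open>\<open>K\<close>, with embedding \<open>h\<close>, is a field of fractions of the domain \<open>R\<close>.\<close>

definition is_fraction_field ::
  "('a, 'm) ring_scheme \<Rightarrow> ('k, 'q) ring_scheme \<Rightarrow> ('a \<Rightarrow> 'k) \<Rightarrow> bool" where
  "is_fraction_field R K h \<longleftrightarrow>
     domain R \<and> field K \<and> h \<in> Ring.ring_hom R K \<and> inj_on h (carrier R) \<and>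
     (\<forall>z \<in> carrier K. \<exists>a \<in> carrier R. \<exists>b \<in> carrier R - {\<zero>\<^bsub>R\<^esub>}.
        z = h a \<otimes>\<^bsub>K\<^esub> inv\<^bsub>K\<^esub> (h b))"

text \<open>Polynomials are coefficient lists with the leading coefficient first.\<close>

definition integral_element ::
  "('a, 'm) ring_scheme \<Rightarrow> ('k, 'q) ring_scheme \<Rightarrow> ('a \<Rightarrow> 'k) \<Rightarrow> 'k \<Rightarrow> bool" where
  "integral_element R K h z \<longleftrightarrow> z \<in> carrier K \<and>
     (\<exists>p \<in> carrier (poly_ring R). p \<noteq> [] \<and> hd p = \<one>\<^bsub>R\<^esub> \<and>
        ring.eval K (map h p) z = \<zero>\<^bsub>K\<^esub>)"

definition integrally_closed_in ::
  "('a, 'm) ring_scheme \<Rightarrow> ('k, 'q) ring_scheme \<Rightarrow> ('a \<Rightarrow> 'k) \<Rightarrow> bool" where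
  "integrally_closed_in R K h \<longleftrightarrow> (\<forall>z. integral_element R K h z \<longrightarrow> z \<in> h ` carrier R)"

text \<open>A ring of characteristic \<open>2\<close> is perfect if its Frobenius endomorphism is bijective.\<close>

definition perfect_ring_char2 :: "('a, 'm) ring_scheme \<Rightarrow> bool" where
  "perfect_ring_char2 R \<longleftrightarrow>
     \<one>\<^bsub>R\<^esub> \<noteq> \<zero>\<^bsub>R\<^esub> \<and> \<one>\<^bsub>R\<^esub> \<oplus>\<^bsub>R\<^esub> \<one>\<^bsub>R\<^esub> = \<zero>\<^bsub>R\<^esub> \<and>
     bij_betw (\<lambda>x. x [^]\<^bsub>R\<^esub> (2::nat)) (carrier R) (carrier R)"

end

(*
A symmetric product S = A N of an invertible N with A = ((a, b x), (0, b c)) presents an isomorphism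
between coker A and its dual. Here coker A is the invertible module over R/(abc) glued along x from
R/(ac) and R/(bc), so x^2 splits into a unit modulo ac and a unit modulo bc. If every element is a
square, every unit modulo c splits in this way.

(SU)_2 applied to matrices with zero second row makes R a Hermite ring. Over a Hermite ring an
m x n matrix is a scalar times a unimodular one, and a unimodular matrix A is equivalent to
the direct sum of 1 and a smaller block as soon as p A q = 1 for some row p and column q. The existence of p and q reduces
to the triangular 2 x 2 case ((a, b), (0, c)): split b modulo gcd(a, c) into a unit u modulo a and a
unit v modulo c, choose p with p v = 1 modulo c, and use that a Hermite ring has stable range at most 2.
*)

theory Submission
  imports Defs
begin

section \<open>Comaximal elements and the splitting of squares\<close>

text \<open>Why a square: if a module is glued along \<open>x\<close>, its dual is glued along the
  inverse of \<open>x\<close>. Two such modules are isomorphic only if their gluing units differ by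
  a unit modulo \<open>a c\<close> times a unit modulo \<open>b c\<close>. An isomorphism with the
  dual therefore splits \<open>x^2\<close> and not \<open>x\<close>. The modules themselves do not
  occur below; the two units are read off the entries of \<open>A N\<close> and of the inverse of
  \<open>N\<close>. Being a unit modulo \<open>y\<close> is expressed by a Bezout relation in the
  ring itself, and cosets are needed only to reach the two unit properties. In the triangular case
  the row \<open>(p, q)\<close> must make \<open>p a\<close> and \<open>p b + q c\<close> comaximal.
  The splitting makes \<open>p b + q c\<close> a unit modulo \<open>a\<close> and \<open>p\<close> a
  unit modulo \<open>c\<close>, but \<open>p\<close> and \<open>q\<close> may still share a factor.
  The stable range removes it by adding multiples of \<open>a c\<close>, which disturbs neither
  congruence. Since zero divisors are allowed, dividing by a common divisor is not a determined
  operation. Every extraction of a common factor therefore returns cofactors together with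
  coefficients that combine them to 1.\<close>

definition comaximal :: "('a, 'm) ring_scheme \<Rightarrow> 'a \<Rightarrow> 'a \<Rightarrow> bool" where
  "comaximal R x y \<longleftrightarrow> (\<exists>r \<in> carrier R. \<exists>s \<in> carrier R. r \<otimes>\<^bsub>R\<^esub> x \<oplus>\<^bsub>R\<^esub> s \<otimes>\<^bsub>R\<^esub> y = \<one>\<^bsub>R\<^esub>)"

context cring
begin

lemma comaximalI:
  assumes "r \<otimes> x \<oplus> s \<otimes> y = \<one>" "r \<in> carrier R" "s \<in> carrier R"
  shows "comaximal R x y"
  using assms unfolding comaximal_def by blast

lemma comaximalE:
  assumes "comaximal R x y"
  obtains r s where "r \<in> carrier R" "s \<in> carrier R" "r \<otimes> x \<oplus> s \<otimes> y = \<one>"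
  using assms unfolding comaximal_def by blast

lemma comaximal_sym:
  assumes "comaximal R x y" "x \<in> carrier R" "y \<in> carrier R"
  shows "comaximal R y x"
proof -
  obtain r s where rs: "r \<in> carrier R" "s \<in> carrier R" "r \<otimes> x \<oplus> s \<otimes> y = \<one>"
    using assms(1) by (rule comaximalE)
  have "s \<otimes> y \<oplus> r \<otimes> x = \<one>"
    using rs assms(2,3) by (simp add: a_comm)
  with rs show ?thesis
    by (intro comaximalI)
qed

text \<open>Multiply the two Bezout relations: of the four resulting terms only the one with
  \<open>y \<otimes> z\<close> lacks a factor \<open>x\<close>.\<close>

lemma comaximal_mult:
  assumes "comaximal R x y" "comaximal R x z" "x \<in> carrier R" "y \<in> carrier R" "z \<in> carrier R"
  shows "comaximal R x (y \<otimes> z)"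
proof -
  obtain r s where rs: "r \<in> carrier R" "s \<in> carrier R" "r \<otimes> x \<oplus> s \<otimes> y = \<one>"
    using assms(1) by (rule comaximalE)
  obtain t w where tw: "t \<in> carrier R" "w \<in> carrier R" "t \<otimes> x \<oplus> w \<otimes> z = \<one>"
    using assms(2) by (rule comaximalE)
  have "(r \<otimes> (t \<otimes> x \<oplus> w \<otimes> z) \<oplus> s \<otimes> y \<otimes> t) \<otimes> x \<oplus> (s \<otimes> w) \<otimes> (y \<otimes> z)
      = (r \<otimes> x \<oplus> s \<otimes> y) \<otimes> (t \<otimes> x \<oplus> w \<otimes> z)"
    using assms(3-5) rs(1,2) tw(1,2) by algebra
  also have "\<dots> = \<one>"
    using rs tw by simp
  finally show ?thesis
    by (rule comaximalI) (use assms(3-5) rs(1,2) tw(1,2) in auto)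
qed

lemma comaximal_mult_left:
  assumes "comaximal R x z" "comaximal R y z" "x \<in> carrier R" "y \<in> carrier R" "z \<in> carrier R"
  shows "comaximal R (x \<otimes> y) z"
  using assms by (meson comaximal_mult comaximal_sym m_closed)

lemma comaximal_factor:
  assumes "comaximal R x (y \<otimes> z)" "x \<in> carrier R" "y \<in> carrier R" "z \<in> carrier R"
  shows "comaximal R x y" "comaximal R x z"
proof -
  obtain r s where rs: "r \<in> carrier R" "s \<in> carrier R" "r \<otimes> x \<oplus> s \<otimes> (y \<otimes> z) = \<one>"
    using assms(1) by (rule comaximalE)
  have "r \<otimes> x \<oplus> (s \<otimes> z) \<otimes> y = \<one>" "r \<otimes> x \<oplus> (s \<otimes> y) \<otimes> z = \<one>"
    using rs assms(2-4) by (simp_all add: m_ac)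
  with rs assms(2-4) show "comaximal R x y" "comaximal R x z"
    by (auto intro!: comaximalI)
qed

text \<open>Being a unit modulo \<open>y\<close> depends only on the residue class modulo
  \<open>y\<close>.\<close>

lemma comaximal_add_mult:
  assumes "comaximal R x y" "x \<in> carrier R" "y \<in> carrier R" "t \<in> carrier R"
  shows "comaximal R (x \<oplus> y \<otimes> t) y"
proof -
  obtain r s where rs: "r \<in> carrier R" "s \<in> carrier R" "r \<otimes> x \<oplus> s \<otimes> y = \<one>"
    using assms(1) by (rule comaximalE)
  have "r \<otimes> (x \<oplus> y \<otimes> t) \<oplus> (s \<ominus> r \<otimes> t) \<otimes> y = r \<otimes> x \<oplus> s \<otimes> y"
    using assms(2-4) rs(1,2) by algebra
  also have "\<dots> = \<one>"
    by (rule rs(3))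
  finally show ?thesis
    by (rule comaximalI) (use assms(2-4) rs(1,2) in auto)
qed

end

text \<open>The \<open>WU2_ring\<close> property on representatives. Both the unit properties and
  the reduction of triangular matrices are derived from this form.\<close>

definition square_splitting :: "('a, 'm) ring_scheme \<Rightarrow> bool" where
  "square_splitting R \<longleftrightarrow> (\<forall>a \<in> carrier R. \<forall>b \<in> carrier R. \<forall>c \<in> carrier R. \<forall>x \<in> carrier R.
     comaximal R a b \<longrightarrow> comaximal R x c \<longrightarrow>
       (\<exists>u \<in> carrier R. \<exists>v \<in> carrier R. \<exists>t \<in> carrier R.
          comaximal R u (a \<otimes>\<^bsub>R\<^esub> c) \<and> comaximal R v (b \<otimes>\<^bsub>R\<^esub> c) \<and>
          u \<otimes>\<^bsub>R\<^esub> v = x \<otimes>\<^bsub>R\<^esub> x \<oplus>\<^bsub>R\<^esub> c \<otimes>\<^bsub>R\<^esub> t))"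

context cring
begin

text \<open>
  For \<open>S = A N\<close> symmetric with \<open>A = ((a, b x), (0, b c))\<close>, the unit modulo \<open>b c\<close> is \<open>s\<^sub>1\<^sub>1\<close> and
  the unit modulo \<open>a c\<close> is the inverse of the value of the quadratic form \<open>S\<close> at \<open>(f, g)\<close>.
\<close>

lemma symmetric_completion_units:
  assumes R: "a \<in> carrier R" "b \<in> carrier R" "c \<in> carrier R" "x \<in> carrier R"
      "\<alpha> \<in> carrier R" "\<beta> \<in> carrier R" "f \<in> carrier R" "g \<in> carrier R"
    and N: "n11 \<in> carrier R" "n12 \<in> carrier R" "n21 \<in> carrier R" "n22 \<in> carrier R"
    and M: "m11 \<in> carrier R" "m12 \<in> carrier R" "m21 \<in> carrier R" "m22 \<in> carrier R"
    and ab: "\<alpha> \<otimes> a \<oplus> \<beta> \<otimes> b = \<one>"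
    and xc: "f \<otimes> x \<oplus> g \<otimes> c = \<one>"
    and NM: "n11 \<otimes> m11 \<oplus> n12 \<otimes> m21 = \<one>" "n11 \<otimes> m12 \<oplus> n12 \<otimes> m22 = \<zero>"
      "n21 \<otimes> m11 \<oplus> n22 \<otimes> m21 = \<zero>" "n21 \<otimes> m12 \<oplus> n22 \<otimes> m22 = \<one>"
    and sym: "a \<otimes> n12 \<oplus> b \<otimes> x \<otimes> n22 = b \<otimes> c \<otimes> n21"
  obtains u v t where "u \<in> carrier R" "v \<in> carrier R" "t \<in> carrier R"
    "comaximal R u (a \<otimes> c)" "comaximal R v (b \<otimes> c)" "u \<otimes> v = x \<otimes> x \<oplus> c \<otimes> t"
proof -
  define s11 where "s11 = a \<otimes> n11 \<oplus> b \<otimes> x \<otimes> n21"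
  have s11: "s11 \<in> carrier R"
    unfolding s11_def using R N by simp
  define l where "l = n21 \<otimes> f \<oplus> n22 \<otimes> g"
  have l: "l \<in> carrier R" unfolding l_def using R N by simp
  \<comment> \<open>With \<open>S = A N\<close> and \<open>M\<close> the inverse of
    \<open>N\<close>, these are the two entries of the first row of \<open>A = S M\<close>; symmetry
    replaces the upper right entry of \<open>S\<close> by \<open>b c n21\<close>.\<close>
  have row1: "s11 \<otimes> m11 \<oplus> b \<otimes> c \<otimes> n21 \<otimes> m21 = a"
  proof -
    have "s11 \<otimes> m11 \<oplus> b \<otimes> c \<otimes> n21 \<otimes> m21 = s11 \<otimes> m11 \<oplus> (a \<otimes> n12 \<oplus> b \<otimes> x \<otimes> n22) \<otimes> m21"
      by (simp only: sym)
    also have "\<dots> = a \<otimes> (n11 \<otimes> m11 \<oplus> n12 \<otimes> m21) \<oplus> b \<otimes> x \<otimes> (n21 \<otimes> m11 \<oplus> n22 \<otimes> m21)"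
      unfolding s11_def using R N M by algebra
    finally show ?thesis using NM R by simp
  qed
  have row2: "s11 \<otimes> m12 \<oplus> b \<otimes> c \<otimes> n21 \<otimes> m22 = b \<otimes> x"
  proof -
    have "s11 \<otimes> m12 \<oplus> b \<otimes> c \<otimes> n21 \<otimes> m22 = s11 \<otimes> m12 \<oplus> (a \<otimes> n12 \<oplus> b \<otimes> x \<otimes> n22) \<otimes> m22"
      by (simp only: sym)
    also have "\<dots> = a \<otimes> (n11 \<otimes> m12 \<oplus> n12 \<otimes> m22) \<oplus> b \<otimes> x \<otimes> (n21 \<otimes> m12 \<oplus> n22 \<otimes> m22)"
      unfolding s11_def using R N M by algebra
    finally show ?thesis using NM R by simp
  qed
  \<comment> \<open>By \<open>row1\<close> and \<open>row2\<close> the ideal of \<open>s11\<close>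
    and \<open>b c\<close> contains \<open>a\<close> and \<open>b x\<close>. It also contains
    \<open>b = f (b x) + g (b c)\<close>, hence 1.\<close>
  have v: "comaximal R s11 (b \<otimes> c)"
  proof (rule comaximalI)
    have "(\<alpha> \<otimes> m11 \<oplus> \<beta> \<otimes> f \<otimes> m12) \<otimes> s11
        \<oplus> (\<alpha> \<otimes> n21 \<otimes> m21 \<oplus> \<beta> \<otimes> f \<otimes> n21 \<otimes> m22 \<oplus> \<beta> \<otimes> g) \<otimes> (b \<otimes> c)
      = \<alpha> \<otimes> (s11 \<otimes> m11 \<oplus> b \<otimes> c \<otimes> n21 \<otimes> m21)
        \<oplus> \<beta> \<otimes> (f \<otimes> (s11 \<otimes> m12 \<oplus> b \<otimes> c \<otimes> n21 \<otimes> m22) \<oplus> b \<otimes> (g \<otimes> c))"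
      using R N M s11 by algebra
    also have "\<dots> = \<alpha> \<otimes> a \<oplus> \<beta> \<otimes> (f \<otimes> (b \<otimes> x) \<oplus> b \<otimes> (g \<otimes> c))"
      by (simp only: row1 row2)
    also have "\<dots> = \<alpha> \<otimes> a \<oplus> \<beta> \<otimes> b \<otimes> (f \<otimes> x \<oplus> g \<otimes> c)"
      using R by algebra
    also have "\<dots> = \<one>" using R ab xc by simp
    finally show "(\<alpha> \<otimes> m11 \<oplus> \<beta> \<otimes> f \<otimes> m12) \<otimes> s11
        \<oplus> (\<alpha> \<otimes> n21 \<otimes> m21 \<oplus> \<beta> \<otimes> f \<otimes> n21 \<otimes> m22 \<oplus> \<beta> \<otimes> g) \<otimes> (b \<otimes> c) = \<one>" .
  qed (use R N M in auto)
  \<comment> \<open>The remaining entries of \<open>S\<close> are \<open>b c n21\<close> (twice) and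
    \<open>b c n22\<close>, so the value of the form at \<open>(f, g)\<close> is
    \<open>s11 f^2 + c h\<close>; the repeated summand is the coefficient 2 of the mixed
    term.\<close>
  define h where "h = n21 \<otimes> b \<otimes> f \<otimes> g \<oplus> n21 \<otimes> b \<otimes> f \<otimes> g \<oplus> n22 \<otimes> b \<otimes> g \<otimes> g"
  have h: "h \<in> carrier R" unfolding h_def using R N by simp
  define u where "u = s11 \<otimes> (f \<otimes> f) \<oplus> c \<otimes> h"
  have u: "u \<in> carrier R" unfolding u_def using R s11 h by simp
  have fc: "comaximal R f c"
    using xc R by (intro comaximalI[of x _ g]) (auto simp: m_comm)
  have s11c: "comaximal R s11 c"
    using v R s11 comaximal_factor by blast
  have uc: "comaximal R u c"
    unfolding u_def using R s11 h fc s11c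
    by (intro comaximal_add_mult comaximal_mult_left) auto
  \<comment> \<open>The row \<open>(f g) A\<close> equals \<open>(a f, b)\<close> because
    \<open>f x + g c = 1\<close>; multiplying it by the column \<open>N (f, g)\<close>, whose second
    coordinate is \<open>l\<close>, gives \<open>u\<close>.\<close>
  have ul: "u = b \<otimes> l \<oplus> a \<otimes> (n11 \<otimes> f \<otimes> f \<oplus> n12 \<otimes> f \<otimes> g)"
  proof -
    have "u = s11 \<otimes> (f \<otimes> f) \<oplus> (b \<otimes> c \<otimes> n21) \<otimes> f \<otimes> g \<oplus> b \<otimes> c \<otimes> n21 \<otimes> f \<otimes> g \<oplus> b \<otimes> c \<otimes> n22 \<otimes> g \<otimes> g"
      unfolding u_def h_def using R N s11 by algebra
    also have "\<dots> = s11 \<otimes> (f \<otimes> f) \<oplus> (a \<otimes> n12 \<oplus> b \<otimes> x \<otimes> n22) \<otimes> f \<otimes> g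
        \<oplus> b \<otimes> c \<otimes> n21 \<otimes> f \<otimes> g \<oplus> b \<otimes> c \<otimes> n22 \<otimes> g \<otimes> g"
      by (simp only: sym)
    also have "\<dots> = b \<otimes> l \<otimes> (f \<otimes> x \<oplus> g \<otimes> c) \<oplus> a \<otimes> (n11 \<otimes> f \<otimes> f \<oplus> n12 \<otimes> f \<otimes> g)"
      unfolding s11_def l_def using R N by algebra
    finally show ?thesis using xc R l by simp
  qed
  have ba: "comaximal R b a"
    using ab R by (intro comaximalI[of \<beta> _ \<alpha>]) (auto simp: a_comm)
  \<comment> \<open>Modulo \<open>a\<close> the symmetry reads \<open>b x n22 = b c n21\<close>.
    Together with \<open>f x + g c = 1\<close> it makes \<open>b (n21, n22)\<close> equal to
    \<open>b l (x, c)\<close>. The row \<open>(n21, n22)\<close> is unimodular and \<open>b\<close>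
    is a unit modulo \<open>a\<close>, so \<open>l\<close> is one too.\<close>
  have la: "comaximal R l a"
  proof (rule comaximalI)
    have bl: "b \<otimes> (x \<otimes> l) = b \<otimes> n21 \<ominus> a \<otimes> n12 \<otimes> g"
      "b \<otimes> (c \<otimes> l) = b \<otimes> n22 \<oplus> a \<otimes> n12 \<otimes> f"
    proof -
      have "b \<otimes> (x \<otimes> l) = b \<otimes> n21 \<otimes> (f \<otimes> x) \<oplus> (a \<otimes> n12 \<oplus> b \<otimes> x \<otimes> n22) \<otimes> g \<ominus> a \<otimes> n12 \<otimes> g"
        unfolding l_def using R N by algebra
      also have "\<dots> = b \<otimes> n21 \<otimes> (f \<otimes> x) \<oplus> (b \<otimes> c \<otimes> n21) \<otimes> g \<ominus> a \<otimes> n12 \<otimes> g"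
        by (simp only: sym)
      also have "\<dots> = b \<otimes> n21 \<otimes> (f \<otimes> x \<oplus> g \<otimes> c) \<ominus> a \<otimes> n12 \<otimes> g"
        using R N by algebra
      finally show "b \<otimes> (x \<otimes> l) = b \<otimes> n21 \<ominus> a \<otimes> n12 \<otimes> g" using xc R N by simp
      have "b \<otimes> (c \<otimes> l) = (b \<otimes> c \<otimes> n21) \<otimes> f \<oplus> b \<otimes> n22 \<otimes> (g \<otimes> c)"
        unfolding l_def using R N by algebra
      also have "\<dots> = (a \<otimes> n12 \<oplus> b \<otimes> x \<otimes> n22) \<otimes> f \<oplus> b \<otimes> n22 \<otimes> (g \<otimes> c)"
        by (simp only: sym)
      also have "\<dots> = b \<otimes> n22 \<otimes> (f \<otimes> x \<oplus> g \<otimes> c) \<oplus> a \<otimes> n12 \<otimes> f"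
        using R N by algebra
      finally show "b \<otimes> (c \<otimes> l) = b \<otimes> n22 \<oplus> a \<otimes> n12 \<otimes> f" using xc R N by simp
    qed
    have "(\<beta> \<otimes> b \<otimes> (x \<otimes> m12 \<oplus> c \<otimes> m22)) \<otimes> l \<oplus> (\<alpha> \<oplus> \<beta> \<otimes> (n12 \<otimes> g \<otimes> m12 \<ominus> n12 \<otimes> f \<otimes> m22)) \<otimes> a
      = \<beta> \<otimes> (b \<otimes> (x \<otimes> l) \<otimes> m12 \<oplus> b \<otimes> (c \<otimes> l) \<otimes> m22)
        \<oplus> (\<alpha> \<oplus> \<beta> \<otimes> (n12 \<otimes> g \<otimes> m12 \<ominus> n12 \<otimes> f \<otimes> m22)) \<otimes> a"
      using R N M l by algebra
    also have "\<dots> = \<beta> \<otimes> ((b \<otimes> n21 \<ominus> a \<otimes> n12 \<otimes> g) \<otimes> m12 \<oplus> (b \<otimes> n22 \<oplus> a \<otimes> n12 \<otimes> f) \<otimes> m22)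
        \<oplus> (\<alpha> \<oplus> \<beta> \<otimes> (n12 \<otimes> g \<otimes> m12 \<ominus> n12 \<otimes> f \<otimes> m22)) \<otimes> a"
      by (simp only: bl)
    also have "\<dots> = \<beta> \<otimes> b \<otimes> (n21 \<otimes> m12 \<oplus> n22 \<otimes> m22) \<oplus> \<alpha> \<otimes> a"
      using R N M by algebra
    also have "\<dots> = \<one>" using R ab NM by (simp add: a_comm)
    finally show "(\<beta> \<otimes> b \<otimes> (x \<otimes> m12 \<oplus> c \<otimes> m22)) \<otimes> l
        \<oplus> (\<alpha> \<oplus> \<beta> \<otimes> (n12 \<otimes> g \<otimes> m12 \<ominus> n12 \<otimes> f \<otimes> m22)) \<otimes> a = \<one>" .
  qed (use R N M in auto)
  have ua: "comaximal R u a"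
    unfolding ul using R N l ba la
    by (intro comaximal_add_mult comaximal_mult_left) auto
  have uac: "comaximal R u (a \<otimes> c)"
    using ua uc u R by (intro comaximal_mult)
  \<comment> \<open>The unit wanted modulo \<open>a c\<close> is \<open>w\<close>, the inverse of
    \<open>u\<close>: modulo \<open>c\<close> it turns \<open>s11 = u x^2\<close> into
    \<open>w s11 = x^2\<close>.\<close>
  obtain w z where wz: "w \<in> carrier R" "z \<in> carrier R" "w \<otimes> u \<oplus> z \<otimes> (a \<otimes> c) = \<one>"
    using uac by (rule comaximalE)
  have w: "comaximal R w (a \<otimes> c)"
    using wz u R by (intro comaximalI[of u _ z]) (auto simp: m_comm)
  \<comment> \<open>Modulo \<open>c\<close>, \<open>f\<close> is the inverse of \<open>x\<close> and
    \<open>u = s11 f^2\<close>, so \<open>u x^2 = s11\<close>; \<open>k\<close> is the quotient of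
    the difference by \<open>c\<close>.\<close>
  define k where "k = s11 \<otimes> f \<otimes> x \<otimes> g \<oplus> s11 \<otimes> g \<ominus> h \<otimes> x \<otimes> x"
  have k: "k \<in> carrier R" unfolding k_def using R s11 h by simp
  have "s11 = u \<otimes> (x \<otimes> x) \<oplus> c \<otimes> k"
  proof -
    have "u \<otimes> (x \<otimes> x) \<oplus> c \<otimes> k = s11 \<otimes> (f \<otimes> x) \<otimes> (f \<otimes> x \<oplus> g \<otimes> c) \<oplus> s11 \<otimes> (g \<otimes> c)"
      unfolding u_def k_def using R s11 h by algebra
    also have "\<dots> = s11 \<otimes> (f \<otimes> x \<oplus> g \<otimes> c)"
      unfolding xc using R s11 xc by (simp flip: r_distr)
    finally show ?thesis using xc s11 by simp
  qed
  then have "w \<otimes> s11 = w \<otimes> (u \<otimes> (x \<otimes> x) \<oplus> c \<otimes> k)"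
    by simp
  also have "\<dots> = (w \<otimes> u \<oplus> z \<otimes> (a \<otimes> c)) \<otimes> (x \<otimes> x) \<oplus> c \<otimes> (w \<otimes> k \<ominus> z \<otimes> a \<otimes> x \<otimes> x)"
    using R u k wz(1,2) by algebra
  finally have "w \<otimes> s11 = x \<otimes> x \<oplus> c \<otimes> (w \<otimes> k \<ominus> z \<otimes> a \<otimes> x \<otimes> x)"
    using wz R by simp
  then show ?thesis
    using that[of w s11 "w \<otimes> k \<ominus> z \<otimes> a \<otimes> x \<otimes> x"] wz s11 k R w v by simp
qed

end

section \<open>Matrices over a ring with carrier\<close>

context cring
begin

section \<open>Finite sums over initial segments of the natural numbers\<close>

lemma finsum_lessThan_Suc:
  fixes n :: nat
  assumes "\<And>i. i < Suc n \<Longrightarrow> f i \<in> carrier R"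
  shows "(\<Oplus>i\<in>{..<Suc n}. f i) = (\<Oplus>i\<in>{..<n}. f i) \<oplus> f n"
proof -
  have "(\<Oplus>i\<in>{..<Suc n}. f i) = f n \<oplus> (\<Oplus>i\<in>{..<n}. f i)"
    unfolding lessThan_Suc using assms by (intro finsum_insert) (auto simp: Pi_def)
  also have "\<dots> = (\<Oplus>i\<in>{..<n}. f i) \<oplus> f n"
    using assms by (intro a_comm finsum_closed) (auto simp: Pi_def)
  finally show ?thesis .
qed

lemma finsum_lessThan_closed [intro]:
  fixes n :: nat
  assumes "\<And>i. i < n \<Longrightarrow> f i \<in> carrier R"
  shows "(\<Oplus>i\<in>{..<n}. f i) \<in> carrier R"
  using assms by (intro finsum_closed) (auto simp: Pi_def)

lemma finsum_lessThan_cong: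
  fixes n :: nat
  assumes "\<And>i. i < n \<Longrightarrow> f i = g i" "\<And>i. i < n \<Longrightarrow> g i \<in> carrier R"
  shows "(\<Oplus>i\<in>{..<n}. f i) = (\<Oplus>i\<in>{..<n}. g i)"
  using assms by (intro finsum_cong') (auto simp: Pi_def)

lemma finsum_lessThan_zero:
  fixes n :: nat
  assumes "\<And>i. i < n \<Longrightarrow> f i = \<zero>"
  shows "(\<Oplus>i\<in>{..<n}. f i) = \<zero>"
  using finsum_lessThan_cong[of n f "\<lambda>_. \<zero>"] assms by (simp add: finsum_zero)

lemma finsum_lessThan_two:
  assumes "f 0 \<in> carrier R" "f 1 \<in> carrier R"
  shows "(\<Oplus>i\<in>{..<2::nat}. f i) = f 0 \<oplus> f 1"
proof -
  have "{..<2::nat} = {0, 1}" by auto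
  then show ?thesis
    using assms by (simp add: Pi_def)
qed

lemma finsum_lessThan_single:
  fixes n :: nat
  assumes "k < n" "\<And>i. i < n \<Longrightarrow> i \<noteq> k \<Longrightarrow> f i = \<zero>" "f k \<in> carrier R"
  shows "(\<Oplus>i\<in>{..<n}. f i) = f k"
proof -
  have "(\<Oplus>i\<in>{..<n}. f i) = (\<Oplus>i\<in>{..<n}. if k = i then f k else \<zero>)"
    using assms by (intro finsum_lessThan_cong) auto
  also have "\<dots> = f k"
    using assms by (intro finsum_singleton) auto
  finally show ?thesis .
qed

lemma finsum_lessThan_one:
  assumes "f 0 \<in> carrier R"
  shows "(\<Oplus>i\<in>{..<Suc 0}. f i) = f 0"
  using assms by (intro finsum_lessThan_single) auto

lemma finsum_lessThan_add:
  fixes m n :: nat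
  assumes "\<And>i. i < m + n \<Longrightarrow> f i \<in> carrier R"
  shows "(\<Oplus>i\<in>{..<m + n}. f i) = (\<Oplus>i\<in>{..<m}. f i) \<oplus> (\<Oplus>i\<in>{..<n}. f (m + i))"
  using assms
proof (induction n)
  case 0
  then have "(\<Oplus>i\<in>{..<m}. f i) \<in> carrier R" by auto
  then show ?case by simp
next
  case (Suc n)
  have c: "(\<Oplus>i\<in>{..<m}. f i) \<in> carrier R" "(\<Oplus>i\<in>{..<n}. f (m + i)) \<in> carrier R" "f (m + n) \<in> carrier R"
    using Suc.prems by auto
  have "(\<Oplus>i\<in>{..<m + Suc n}. f i) = (\<Oplus>i\<in>{..<m + n}. f i) \<oplus> f (m + n)"
    using Suc.prems by (simp add: finsum_lessThan_Suc)
  also have "\<dots> = (\<Oplus>i\<in>{..<m}. f i) \<oplus> (\<Oplus>i\<in>{..<n}. f (m + i)) \<oplus> f (m + n)"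
    using Suc by simp
  also have "\<dots> = (\<Oplus>i\<in>{..<m}. f i) \<oplus> (\<Oplus>i\<in>{..<Suc n}. f (m + i))"
    using Suc.prems c by (simp add: finsum_lessThan_Suc a_assoc)
  finally show ?case .
qed

lemma finsum_lessThan_swap:
  fixes m n :: nat
  assumes "\<And>i j. i < m \<Longrightarrow> j < n \<Longrightarrow> f i j \<in> carrier R"
  shows "(\<Oplus>i\<in>{..<m}. \<Oplus>j\<in>{..<n}. f i j) = (\<Oplus>j\<in>{..<n}. \<Oplus>i\<in>{..<m}. f i j)"
  using assms
proof (induction m)
  case 0
  then show ?case by (simp add: finsum_zero)
next
  case (Suc m)
  have "(\<Oplus>i\<in>{..<Suc m}. \<Oplus>j\<in>{..<n}. f i j)
      = (\<Oplus>j\<in>{..<n}. \<Oplus>i\<in>{..<m}. f i j) \<oplus> (\<Oplus>j\<in>{..<n}. f m j)"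
    using Suc by (subst finsum_lessThan_Suc) auto
  also have "\<dots> = (\<Oplus>j\<in>{..<n}. (\<Oplus>i\<in>{..<m}. f i j) \<oplus> f m j)"
    using Suc.prems by (subst finsum_addf) (auto simp: Pi_def)
  also have "\<dots> = (\<Oplus>j\<in>{..<n}. \<Oplus>i\<in>{..<Suc m}. f i j)"
    using Suc.prems by (intro finsum_lessThan_cong) (auto simp: finsum_lessThan_Suc)
  finally show ?case .
qed

lemma finsum_lessThan_distrib_left:
  fixes n :: nat
  assumes "a \<in> carrier R" "\<And>i. i < n \<Longrightarrow> f i \<in> carrier R"
  shows "a \<otimes> (\<Oplus>i\<in>{..<n}. f i) = (\<Oplus>i\<in>{..<n}. a \<otimes> f i)"
  using assms by (intro finsum_rdistr) (auto simp: Pi_def)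

lemma finsum_lessThan_distrib_right:
  fixes n :: nat
  assumes "a \<in> carrier R" "\<And>i. i < n \<Longrightarrow> f i \<in> carrier R"
  shows "(\<Oplus>i\<in>{..<n}. f i) \<otimes> a = (\<Oplus>i\<in>{..<n}. f i \<otimes> a)"
  using assms by (intro finsum_ldistr) (auto simp: Pi_def)

end

section \<open>Matrix algebra with entries in the carrier\<close>

lemma ring_mats_iff:
  "A \<in> ring_mats R m n \<longleftrightarrow>
     dim_row A = m \<and> dim_col A = n \<and> (\<forall>i<m. \<forall>j<n. A $$ (i, j) \<in> carrier R)"
  unfolding ring_mats_def by (auto simp: subset_iff intro!: elements_matI)

lemma ring_matsD:
  assumes "A \<in> ring_mats R m n"
  shows "dim_row A = m" "dim_col A = n" "\<And>i j. i < m \<Longrightarrow> j < n \<Longrightarrow> A $$ (i, j) \<in> carrier R"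
  using assms by (auto simp: ring_mats_iff)

lemma mat_in_ring_mats:
  assumes "\<And>i j. i < m \<Longrightarrow> j < n \<Longrightarrow> f (i, j) \<in> carrier R"
  shows "mat m n f \<in> ring_mats R m n"
  using assms by (simp add: ring_mats_iff)

lemma dim_rmat_mult [simp]:
  "dim_row (rmat_mult R A B) = dim_row A" "dim_col (rmat_mult R A B) = dim_col B"
  by (simp_all add: rmat_mult_def)

lemma index_rmat_mult:
  assumes "A \<in> ring_mats R m k" "B \<in> ring_mats R k n" "i < m" "j < n"
  shows "rmat_mult R A B $$ (i, j) = (\<Oplus>\<^bsub>R\<^esub>l\<in>{..<k}. A $$ (i, l) \<otimes>\<^bsub>R\<^esub> B $$ (l, j))"
  using assms by (simp add: rmat_mult_def ring_mats_iff)

text \<open>Block diagonal sum. Rectangular and empty blocks are allowed, since the diagonal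
  reduction splits off corners until no rows or no columns are left.\<close>

definition dsum :: "('a, 'm) ring_scheme \<Rightarrow> 'a mat \<Rightarrow> 'a mat \<Rightarrow> 'a mat" where
  "dsum R A B = mat (dim_row A + dim_row B) (dim_col A + dim_col B) (\<lambda>(i, j).
     if i < dim_row A then (if j < dim_col A then A $$ (i, j) else \<zero>\<^bsub>R\<^esub>)
     else (if j < dim_col A then \<zero>\<^bsub>R\<^esub> else B $$ (i - dim_row A, j - dim_col A)))"

context cring
begin

lemma rmat_mult_closed:
  assumes "A \<in> ring_mats R m k" "B \<in> ring_mats R k n"
  shows "rmat_mult R A B \<in> ring_mats R m n"
  unfolding ring_mats_iff using assms
  by (auto simp: index_rmat_mult[OF assms] ring_mats_iff intro!: finsum_lessThan_closed)

lemma rmat_one_closed: "rmat_one R n \<in> ring_mats R n n"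
  by (simp add: ring_mats_iff rmat_one_def)

lemma index_rmat_one:
  "i < n \<Longrightarrow> j < n \<Longrightarrow> rmat_one R n $$ (i, j) = (if i = j then \<one> else \<zero>)"
  by (simp add: rmat_one_def)

lemma ring_mats_eqI:
  assumes "A \<in> ring_mats R m n" "B \<in> ring_mats R m n"
    "\<And>i j. i < m \<Longrightarrow> j < n \<Longrightarrow> A $$ (i, j) = B $$ (i, j)"
  shows "A = B"
proof (rule eq_matI)
  show "dim_row A = dim_row B" "dim_col A = dim_col B"
    using assms(1,2) by (simp_all add: ring_mats_iff)
  fix i j assume "i < dim_row B" "j < dim_col B"
  then show "A $$ (i, j) = B $$ (i, j)"
    using assms(2) by (intro assms(3)) (simp_all add: ring_mats_iff)
qed

lemma rmat_mult_one_left: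
  assumes "A \<in> ring_mats R m n"
  shows "rmat_mult R (rmat_one R m) A = A"
proof (rule ring_mats_eqI[OF rmat_mult_closed[OF rmat_one_closed assms] assms])
  fix i j assume ij: "i < m" "j < n"
  have "rmat_mult R (rmat_one R m) A $$ (i, j) = (\<Oplus>l\<in>{..<m}. rmat_one R m $$ (i, l) \<otimes> A $$ (l, j))"
    by (rule index_rmat_mult[OF rmat_one_closed assms ij])
  also have "\<dots> = rmat_one R m $$ (i, i) \<otimes> A $$ (i, j)"
    using ij assms by (intro finsum_lessThan_single) (simp_all add: index_rmat_one ring_matsD(3)[OF assms])
  finally show "rmat_mult R (rmat_one R m) A $$ (i, j) = A $$ (i, j)"
    using ij assms by (simp add: index_rmat_one ring_matsD(3)[OF assms])
qed

text \<open>Interchange of the two sums. It serves the associativity of the matrix product and,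
  later, the exchange of \<open>p\<close> and \<open>q\<close> under transposition.\<close>

lemma finsum_mult_assoc:
  fixes m n :: nat
  assumes "\<And>i. i < m \<Longrightarrow> p i \<in> carrier R" "\<And>j. j < n \<Longrightarrow> q j \<in> carrier R"
    "\<And>i j. i < m \<Longrightarrow> j < n \<Longrightarrow> a i j \<in> carrier R"
  shows "(\<Oplus>j\<in>{..<n}. (\<Oplus>i\<in>{..<m}. p i \<otimes> a i j) \<otimes> q j)
    = (\<Oplus>i\<in>{..<m}. p i \<otimes> (\<Oplus>j\<in>{..<n}. a i j \<otimes> q j))"
proof -
  have "(\<Oplus>j\<in>{..<n}. (\<Oplus>i\<in>{..<m}. p i \<otimes> a i j) \<otimes> q j)
      = (\<Oplus>j\<in>{..<n}. \<Oplus>i\<in>{..<m}. p i \<otimes> a i j \<otimes> q j)"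
    using assms by (intro finsum_lessThan_cong) (auto simp: finsum_lessThan_distrib_right)
  also have "\<dots> = (\<Oplus>i\<in>{..<m}. \<Oplus>j\<in>{..<n}. p i \<otimes> a i j \<otimes> q j)"
    using assms by (intro finsum_lessThan_swap) auto
  also have "\<dots> = (\<Oplus>i\<in>{..<m}. \<Oplus>j\<in>{..<n}. p i \<otimes> (a i j \<otimes> q j))"
    using assms by (intro finsum_lessThan_cong finsum_lessThan_closed) (auto simp: m_assoc)
  also have "\<dots> = (\<Oplus>i\<in>{..<m}. p i \<otimes> (\<Oplus>j\<in>{..<n}. a i j \<otimes> q j))"
    using assms by (intro finsum_lessThan_cong) (auto simp: finsum_lessThan_distrib_left)
  finally show ?thesis .
qed

lemma rmat_mult_assoc:
  assumes A: "A \<in> ring_mats R m k" and B: "B \<in> ring_mats R k l" and C: "C \<in> ring_mats R l n"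
  shows "rmat_mult R (rmat_mult R A B) C = rmat_mult R A (rmat_mult R B C)"
proof (rule ring_mats_eqI)
  note AB = rmat_mult_closed[OF A B] and BC = rmat_mult_closed[OF B C]
  show "rmat_mult R (rmat_mult R A B) C \<in> ring_mats R m n"
    by (rule rmat_mult_closed[OF AB C])
  show "rmat_mult R A (rmat_mult R B C) \<in> ring_mats R m n"
    by (rule rmat_mult_closed[OF A BC])
  fix i j assume ij: "i < m" "j < n"
  have "rmat_mult R (rmat_mult R A B) C $$ (i, j)
      = (\<Oplus>t\<in>{..<l}. (\<Oplus>s\<in>{..<k}. A $$ (i, s) \<otimes> B $$ (s, t)) \<otimes> C $$ (t, j))"
    unfolding index_rmat_mult[OF AB C ij] using A B C ij
    by (intro finsum_lessThan_cong) (auto simp: index_rmat_mult[OF A B] ring_mats_iff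
        intro!: m_closed finsum_lessThan_closed)
  also have "\<dots> = (\<Oplus>s\<in>{..<k}. A $$ (i, s) \<otimes> (\<Oplus>t\<in>{..<l}. B $$ (s, t) \<otimes> C $$ (t, j)))"
    using A B C ij by (intro finsum_mult_assoc) (simp_all add: ring_mats_iff)
  also have "\<dots> = rmat_mult R A (rmat_mult R B C) $$ (i, j)"
    unfolding index_rmat_mult[OF A BC ij] using A B C ij BC
    by (intro finsum_lessThan_cong) (simp_all add: index_rmat_mult[OF B C, symmetric] ring_mats_iff)
  finally show "rmat_mult R (rmat_mult R A B) C $$ (i, j) = rmat_mult R A (rmat_mult R B C) $$ (i, j)" .
qed

lemma transpose_closed:
  "A \<in> ring_mats R m n \<Longrightarrow> transpose_mat A \<in> ring_mats R n m"
  by (auto simp: ring_mats_iff)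

lemma transpose_rmat_mult:
  assumes A: "A \<in> ring_mats R m k" and B: "B \<in> ring_mats R k n"
  shows "transpose_mat (rmat_mult R A B) = rmat_mult R (transpose_mat B) (transpose_mat A)"
proof (rule ring_mats_eqI)
  note A' = transpose_closed[OF A] and B' = transpose_closed[OF B]
  show "transpose_mat (rmat_mult R A B) \<in> ring_mats R n m"
    by (intro transpose_closed rmat_mult_closed[OF A B])
  show "rmat_mult R (transpose_mat B) (transpose_mat A) \<in> ring_mats R n m"
    by (rule rmat_mult_closed[OF B' A'])
  fix i j assume ij: "i < n" "j < m"
  have "transpose_mat (rmat_mult R A B) $$ (i, j) = (\<Oplus>l\<in>{..<k}. A $$ (j, l) \<otimes> B $$ (l, i))"
    using ij A B by (simp add: ring_matsD(1)[OF A] ring_matsD(2)[OF B] index_rmat_mult[OF A B ij(2,1)])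
  also have "\<dots> = rmat_mult R (transpose_mat B) (transpose_mat A) $$ (i, j)"
    unfolding index_rmat_mult[OF B' A' ij] using ij A B
    by (intro finsum_lessThan_cong) (auto simp: ring_mats_iff m_comm)
  finally show "transpose_mat (rmat_mult R A B) $$ (i, j)
      = rmat_mult R (transpose_mat B) (transpose_mat A) $$ (i, j)" .
qed

lemma transpose_rmat_one: "transpose_mat (rmat_one R n) = rmat_one R n"
  by (intro eq_matI) (auto simp: rmat_one_def)

lemma GL_I:
  assumes "N \<in> ring_mats R n n" "N' \<in> ring_mats R n n"
    "rmat_mult R N N' = rmat_one R n" "rmat_mult R N' N = rmat_one R n"
  shows "N \<in> GL R n"
  using assms unfolding GL_def by blast

lemma GL_E:
  assumes "N \<in> GL R n"
  obtains N' where "N \<in> ring_mats R n n" "N' \<in> ring_mats R n n"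
    "rmat_mult R N N' = rmat_one R n" "rmat_mult R N' N = rmat_one R n"
  using assms unfolding GL_def by blast

lemma GL_closed: "N \<in> GL R n \<Longrightarrow> N \<in> ring_mats R n n"
  by (rule GL_E)

lemma GL_one: "rmat_one R n \<in> GL R n"
  by (rule GL_I[of _ _ "rmat_one R n"]) (simp_all add: rmat_one_closed rmat_mult_one_left[OF rmat_one_closed])

lemma GL_mult:
  assumes "M \<in> GL R n" "N \<in> GL R n"
  shows "rmat_mult R M N \<in> GL R n"
proof -
  obtain M' where M: "M \<in> ring_mats R n n" "M' \<in> ring_mats R n n"
    "rmat_mult R M M' = rmat_one R n" "rmat_mult R M' M = rmat_one R n"
    using assms(1) by (rule GL_E)
  obtain N' where N: "N \<in> ring_mats R n n" "N' \<in> ring_mats R n n"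
    "rmat_mult R N N' = rmat_one R n" "rmat_mult R N' N = rmat_one R n"
    using assms(2) by (rule GL_E)
  \<comment> \<open>Stated for arbitrary factors, so that the products in both orders are
    instances.\<close>
  have cancel: "rmat_mult R (rmat_mult R A B) (rmat_mult R B' A') = rmat_one R n"
    if "A \<in> ring_mats R n n" "B \<in> ring_mats R n n" "B' \<in> ring_mats R n n" "A' \<in> ring_mats R n n"
      "rmat_mult R B B' = rmat_one R n" "rmat_mult R A A' = rmat_one R n" for A B B' A'
  proof -
    have "rmat_mult R (rmat_mult R A B) (rmat_mult R B' A')
        = rmat_mult R A (rmat_mult R (rmat_mult R B B') A')"
      using that(1-4) by (simp add: rmat_mult_assoc[of _ n n _ n _ n] rmat_mult_closed)
    then show ?thesis
      using that by (simp add: rmat_mult_one_left)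
  qed
  show ?thesis
    using M N by (intro GL_I[of _ _ "rmat_mult R N' M'"] rmat_mult_closed cancel)
qed

lemma GL_transpose:
  assumes "N \<in> GL R n"
  shows "transpose_mat N \<in> GL R n"
proof -
  obtain N' where N: "N \<in> ring_mats R n n" "N' \<in> ring_mats R n n"
    "rmat_mult R N N' = rmat_one R n" "rmat_mult R N' N = rmat_one R n"
    using assms by (rule GL_E)
  then show ?thesis
    by (intro GL_I[of _ _ "transpose_mat N'"])
      (simp_all add: transpose_closed transpose_rmat_one flip: transpose_rmat_mult)
qed

lemma dsum_closed:
  assumes "A \<in> ring_mats R m n" "B \<in> ring_mats R k l"
  shows "dsum R A B \<in> ring_mats R (m + k) (n + l)"
  using assms by (auto simp: dsum_def ring_mats_iff)

lemma index_dsum: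
  assumes "A \<in> ring_mats R m n" "B \<in> ring_mats R k l" "i < m + k" "j < n + l"
  shows "dsum R A B $$ (i, j) =
     (if i < m then (if j < n then A $$ (i, j) else \<zero>)
      else (if j < n then \<zero> else B $$ (i - m, j - n)))"
  using assms by (auto simp: dsum_def ring_mats_iff)

text \<open>The summation index is split at \<open>n\<close>: the zero blocks kill the second half
  in the first \<open>m\<close> rows and the first half in the rows below.\<close>

lemma dsum_mult:
  assumes A: "A \<in> ring_mats R m n" and B: "B \<in> ring_mats R k l"
    and C: "C \<in> ring_mats R n r" and D: "D \<in> ring_mats R l s"
  shows "rmat_mult R (dsum R A B) (dsum R C D) = dsum R (rmat_mult R A C) (rmat_mult R B D)"
proof (rule ring_mats_eqI)
  note AB = dsum_closed[OF A B] and CD = dsum_closed[OF C D]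
    and AC = rmat_mult_closed[OF A C] and BD = rmat_mult_closed[OF B D]
  show "rmat_mult R (dsum R A B) (dsum R C D) \<in> ring_mats R (m + k) (r + s)"
    by (rule rmat_mult_closed[OF AB CD])
  show "dsum R (rmat_mult R A C) (rmat_mult R B D) \<in> ring_mats R (m + k) (r + s)"
    by (rule dsum_closed[OF AC BD])
  fix i j assume ij: "i < m + k" "j < r + s"
  have corner: "m \<le> i \<Longrightarrow> t < l \<Longrightarrow> B $$ (i - m, t) \<in> carrier R"
    "r \<le> j \<Longrightarrow> t < l \<Longrightarrow> D $$ (t, j - r) \<in> carrier R" for t
    using ij B D by (simp_all add: ring_mats_iff less_diff_conv2)
  have "rmat_mult R (dsum R A B) (dsum R C D) $$ (i, j)
    = (\<Oplus>t\<in>{..<n}. dsum R A B $$ (i, t) \<otimes> dsum R C D $$ (t, j))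
      \<oplus> (\<Oplus>t\<in>{..<l}. dsum R A B $$ (i, n + t) \<otimes> dsum R C D $$ (n + t, j))"
    unfolding index_rmat_mult[OF AB CD ij]
    using ij AB CD by (intro finsum_lessThan_add) (simp add: ring_mats_iff)
  also have "(\<Oplus>t\<in>{..<n}. dsum R A B $$ (i, t) \<otimes> dsum R C D $$ (t, j))
    = (if i < m \<and> j < r then rmat_mult R A C $$ (i, j) else \<zero>)"
    using ij A B C D by (auto simp: index_dsum[OF A B] index_dsum[OF C D] index_rmat_mult[OF A C]
        intro!: finsum_lessThan_cong finsum_lessThan_zero l_null r_null simp: ring_mats_iff)
  also have "(\<Oplus>t\<in>{..<l}. dsum R A B $$ (i, n + t) \<otimes> dsum R C D $$ (n + t, j))
    = (if i \<ge> m \<and> j \<ge> r then rmat_mult R B D $$ (i - m, j - r) else \<zero>)"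
    using ij corner A B C D by (auto simp: index_dsum[OF A B] index_dsum[OF C D] index_rmat_mult[OF B D]
        intro!: finsum_lessThan_cong finsum_lessThan_zero l_null r_null simp: ring_mats_iff)
  finally show "rmat_mult R (dsum R A B) (dsum R C D) $$ (i, j)
      = dsum R (rmat_mult R A C) (rmat_mult R B D) $$ (i, j)"
    using ij AC BD by (simp add: index_dsum[OF AC BD] ring_mats_iff less_diff_conv2)
qed

lemma dsum_one: "dsum R (rmat_one R m) (rmat_one R n) = rmat_one R (m + n)"
  by (intro eq_matI) (auto simp: dsum_def rmat_one_def)

lemma GL_dsum:
  assumes "M \<in> GL R m" "N \<in> GL R n"
  shows "dsum R M N \<in> GL R (m + n)"
proof -
  obtain M' where M: "M \<in> ring_mats R m m" "M' \<in> ring_mats R m m"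
    "rmat_mult R M M' = rmat_one R m" "rmat_mult R M' M = rmat_one R m"
    using assms(1) by (rule GL_E)
  obtain N' where N: "N \<in> ring_mats R n n" "N' \<in> ring_mats R n n"
    "rmat_mult R N N' = rmat_one R n" "rmat_mult R N' N = rmat_one R n"
    using assms(2) by (rule GL_E)
  show ?thesis
    using M N by (intro GL_I[of _ _ "dsum R M' N'"] dsum_closed)
      (simp_all add: dsum_mult[of _ m m _ n n _ m _ n] dsum_one)
qed

end

section \<open>Explicit two by two matrices\<close>

definition mat2 :: "'a \<Rightarrow> 'a \<Rightarrow> 'a \<Rightarrow> 'a \<Rightarrow> 'a mat" where
  "mat2 a b c d = mat 2 2 (\<lambda>(i, j). if i = 0 then (if j = 0 then a else b) else (if j = 0 then c else d))"

lemma index_mat2 [simp]: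
  "mat2 a b c d $$ (0, 0) = a" "mat2 a b c d $$ (0, Suc 0) = b"
  "mat2 a b c d $$ (Suc 0, 0) = c" "mat2 a b c d $$ (Suc 0, Suc 0) = d"
  by (simp_all add: mat2_def)

lemma dim_mat2 [simp]: "dim_row (mat2 a b c d) = 2" "dim_col (mat2 a b c d) = 2"
  by (simp_all add: mat2_def)

lemma less_two_cases: "(i::nat) < 2 \<Longrightarrow> i = 0 \<or> i = Suc 0"
  by auto

lemma mat2_eta:
  assumes "A \<in> ring_mats R 2 2"
  shows "A = mat2 (A $$ (0, 0)) (A $$ (0, Suc 0)) (A $$ (Suc 0, 0)) (A $$ (Suc 0, Suc 0))"
  using assms by (intro eq_matI) (auto simp: ring_mats_iff dest!: less_two_cases)

lemma mat2_in_ring_mats [simp]: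
  "mat2 a b c d \<in> ring_mats R 2 2 \<longleftrightarrow> a \<in> carrier R \<and> b \<in> carrier R \<and> c \<in> carrier R \<and> d \<in> carrier R"
proof
  assume "mat2 a b c d \<in> ring_mats R 2 2"
  then have "mat2 a b c d $$ (i, j) \<in> carrier R" if "i < 2" "j < 2" for i j
    using that by (simp add: ring_mats_iff)
  from this[of 0 0] this[of 0 1] this[of 1 0] this[of 1 1]
  show "a \<in> carrier R \<and> b \<in> carrier R \<and> c \<in> carrier R \<and> d \<in> carrier R"
    by simp
qed (auto simp: ring_mats_iff dest!: less_two_cases)

lemma mat2_eq_iff: "mat2 a b c d = mat2 a' b' c' d' \<longleftrightarrow> a = a' \<and> b = b' \<and> c = c' \<and> d = d'"
  by (auto dest: arg_cong[of _ _ "\<lambda>A. (A $$ (0, 0), A $$ (0, 1), A $$ (1, 0), A $$ (1, 1))"])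

lemma symmetric_mat2_iff: "symmetric_mat (mat2 a b c d) \<longleftrightarrow> b = c"
proof -
  have "transpose_mat (mat2 a b c d) = mat2 a c b d"
    by (intro eq_matI) (auto dest!: less_two_cases)
  then show ?thesis by (auto simp: symmetric_mat_def mat2_eq_iff)
qed

lemma elements_mat2: "elements_mat (mat2 a b c d) = {a, b, c, d}"
proof -
  have "mat2 a b c d \<in> carrier_mat 2 2" by auto
  from elements_matI[OF this, of 0 0] elements_matI[OF this, of 0 1]
    elements_matI[OF this, of 1 0] elements_matI[OF this, of 1 1]
  have "{a, b, c, d} \<subseteq> elements_mat (mat2 a b c d)" by auto
  then show ?thesis
    by (auto dest!: elements_matD less_two_cases)
qed

lemma rmat_one_2: "rmat_one R 2 = mat2 \<one>\<^bsub>R\<^esub> \<zero>\<^bsub>R\<^esub> \<zero>\<^bsub>R\<^esub> \<one>\<^bsub>R\<^esub>"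
  by (intro eq_matI) (auto simp: rmat_one_def dest!: less_two_cases)

context cring
begin

lemma mat2_mult:
  assumes "a \<in> carrier R" "b \<in> carrier R" "c \<in> carrier R" "d \<in> carrier R"
    "a' \<in> carrier R" "b' \<in> carrier R" "c' \<in> carrier R" "d' \<in> carrier R"
  shows "rmat_mult R (mat2 a b c d) (mat2 a' b' c' d')
    = mat2 (a \<otimes> a' \<oplus> b \<otimes> c') (a \<otimes> b' \<oplus> b \<otimes> d') (c \<otimes> a' \<oplus> d \<otimes> c') (c \<otimes> b' \<oplus> d \<otimes> d')"
proof (rule ring_mats_eqI[of _ 2 2])
  have A: "mat2 a b c d \<in> ring_mats R 2 2" and B: "mat2 a' b' c' d' \<in> ring_mats R 2 2"
    using assms by auto
  show "rmat_mult R (mat2 a b c d) (mat2 a' b' c' d') \<in> ring_mats R 2 2"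
    by (rule rmat_mult_closed[OF A B])
  show "mat2 (a \<otimes> a' \<oplus> b \<otimes> c') (a \<otimes> b' \<oplus> b \<otimes> d') (c \<otimes> a' \<oplus> d \<otimes> c') (c \<otimes> b' \<oplus> d \<otimes> d') \<in> ring_mats R 2 2"
    using assms by auto
  fix i j :: nat assume ij: "i < 2" "j < 2"
  then show "rmat_mult R (mat2 a b c d) (mat2 a' b' c' d') $$ (i, j) =
    mat2 (a \<otimes> a' \<oplus> b \<otimes> c') (a \<otimes> b' \<oplus> b \<otimes> d') (c \<otimes> a' \<oplus> d \<otimes> c') (c \<otimes> b' \<oplus> d \<otimes> d') $$ (i, j)"
    using assms by (auto simp: index_rmat_mult[OF A B] finsum_lessThan_two dest!: less_two_cases)
qed

text \<open>Four equations express that \<open>M\<close> is a right inverse. The last one is the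
  corner entry of the opposite product; it makes the first row of the inverse unimodular, as the
  Hermite property requires.\<close>

lemma GL2_E:
  assumes "N \<in> GL R 2"
  obtains n11 n12 n21 n22 m11 m12 m21 m22 where
    "N = mat2 n11 n12 n21 n22"
    "n11 \<in> carrier R" "n12 \<in> carrier R" "n21 \<in> carrier R" "n22 \<in> carrier R"
    "m11 \<in> carrier R" "m12 \<in> carrier R" "m21 \<in> carrier R" "m22 \<in> carrier R"
    "n11 \<otimes> m11 \<oplus> n12 \<otimes> m21 = \<one>" "n11 \<otimes> m12 \<oplus> n12 \<otimes> m22 = \<zero>"
    "n21 \<otimes> m11 \<oplus> n22 \<otimes> m21 = \<zero>" "n21 \<otimes> m12 \<oplus> n22 \<otimes> m22 = \<one>"
    "m11 \<otimes> n11 \<oplus> m12 \<otimes> n21 = \<one>"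
proof -
  obtain N' where N: "N \<in> ring_mats R 2 2" "N' \<in> ring_mats R 2 2"
    "rmat_mult R N N' = rmat_one R 2" "rmat_mult R N' N = rmat_one R 2"
    using assms by (rule GL_E)
  obtain n11 n12 n21 n22 where n: "N = mat2 n11 n12 n21 n22"
    using mat2_eta[OF N(1)] by blast
  obtain m11 m12 m21 m22 where m: "N' = mat2 m11 m12 m21 m22"
    using mat2_eta[OF N(2)] by blast
  show ?thesis
    using that[OF n, of m11 m12 m21 m22] N unfolding n m
    by (simp add: mat2_mult rmat_one_2 mat2_eq_iff)
qed

lemma mat2_GL:
  assumes "a \<in> carrier R" "b \<in> carrier R" "c \<in> carrier R" "d \<in> carrier R"
    and det: "a \<otimes> d \<ominus> b \<otimes> c = \<one>"
  shows "mat2 a b c d \<in> GL R 2"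
proof (rule GL_I[of _ _ "mat2 d (\<ominus> b) (\<ominus> c) a"])
  have "a \<otimes> d \<oplus> b \<otimes> \<ominus> c = a \<otimes> d \<ominus> b \<otimes> c" "c \<otimes> \<ominus> b \<oplus> d \<otimes> a = a \<otimes> d \<ominus> b \<otimes> c"
    "d \<otimes> a \<oplus> \<ominus> b \<otimes> c = a \<otimes> d \<ominus> b \<otimes> c" "\<ominus> c \<otimes> b \<oplus> a \<otimes> d = a \<otimes> d \<ominus> b \<otimes> c"
    "a \<otimes> \<ominus> b \<oplus> b \<otimes> a = \<zero>" "c \<otimes> d \<oplus> d \<otimes> \<ominus> c = \<zero>"
    "d \<otimes> b \<oplus> \<ominus> b \<otimes> d = \<zero>" "\<ominus> c \<otimes> a \<oplus> a \<otimes> c = \<zero>"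
    using assms(1-4) by algebra+
  then show "rmat_mult R (mat2 a b c d) (mat2 d (\<ominus> b) (\<ominus> c) a) = rmat_one R 2"
    "rmat_mult R (mat2 d (\<ominus> b) (\<ominus> c) a) (mat2 a b c d) = rmat_one R 2"
    using assms by (simp_all add: mat2_mult rmat_one_2 mat2_eq_iff)
qed (use assms(1-4) in simp_all)

end

section \<open>Units of principal quotients\<close>

context cring
begin

text \<open>The generated ideal is defined as an intersection and gives no coefficients by itself.
  By minimality it lies in the sum of the two principal ideals, whose elements have the form
  \<open>r a + s b\<close>.\<close>

lemma comaximal_if_Idl:
  assumes "a \<in> carrier R" "b \<in> carrier R" "Idl {a, b} = carrier R"
  shows "comaximal R a b"
proof -
  have I: "ideal (PIdl a <+> PIdl b) R"
    using assms by (intro add_ideals cgenideal_ideal)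
  have "\<zero> \<in> PIdl a" "\<zero> \<in> PIdl b"
    using assms by (simp_all add: cgenideal_ideal additive_subgroup.zero_closed ideal.axioms(1))
  moreover have "a \<in> PIdl a" "b \<in> PIdl b"
    using assms by (simp_all add: cgenideal_self)
  ultimately have "a \<oplus> \<zero> \<in> PIdl a <+> PIdl b" "\<zero> \<oplus> b \<in> PIdl a <+> PIdl b"
    unfolding set_add_def' by blast+
  then have "{a, b} \<subseteq> PIdl a <+> PIdl b"
    using assms by simp
  then have "\<one> \<in> PIdl a <+> PIdl b"
    using genideal_minimal[OF I] assms(3) by blast
  then obtain r s where "r \<in> carrier R" "s \<in> carrier R" "\<one> = r \<otimes> a \<oplus> s \<otimes> b"
    unfolding set_add_def' cgenideal_def by blast
  then show ?thesis
    by (intro comaximalI[of r a s b]) simp_all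
qed

lemma Idl_eq_carrierI:
  assumes "S \<subseteq> carrier R" "\<And>I. ideal I R \<Longrightarrow> S \<subseteq> I \<Longrightarrow> \<one> \<in> I"
  shows "Idl S = carrier R"
  using ideal.one_imp_carrier[OF genideal_ideal[OF assms(1)]]
    assms(2)[OF genideal_ideal[OF assms(1)] genideal_self[OF assms(1)]] .

lemma square_splitting_if_WSU2:
  assumes "WSU2_ring R"
  shows "square_splitting R"
  unfolding square_splitting_def
proof (intro ballI impI)
  fix a b c x
  assume R: "a \<in> carrier R" "b \<in> carrier R" "c \<in> carrier R" "x \<in> carrier R"
    and ab: "comaximal R a b" and xc: "comaximal R x c"
  obtain \<alpha> \<beta> where \<alpha>\<beta>: "\<alpha> \<in> carrier R" "\<beta> \<in> carrier R" "\<alpha> \<otimes> a \<oplus> \<beta> \<otimes> b = \<one>"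
    using ab by (rule comaximalE)
  obtain f g where fg: "f \<in> carrier R" "g \<in> carrier R" "f \<otimes> x \<oplus> g \<otimes> c = \<one>"
    using xc by (rule comaximalE)
  define A where "A = mat2 a (b \<otimes> x) \<zero> (b \<otimes> c)"
  have "Idl {a, b \<otimes> x, \<zero>, b \<otimes> c} = carrier R"
  proof (rule Idl_eq_carrierI)
    fix I assume I: "ideal I R" and S: "{a, b \<otimes> x, \<zero>, b \<otimes> c} \<subseteq> I"
    interpret I: ideal I R by (rule I)
    \<comment> \<open>The inner combination equals \<open>b\<close>, because
      \<open>f x + g c = 1\<close>; so an ideal that contains the entries contains both
      \<open>a\<close> and \<open>b\<close>.\<close>
    have "\<alpha> \<otimes> a \<oplus> \<beta> \<otimes> (f \<otimes> (b \<otimes> x) \<oplus> g \<otimes> (b \<otimes> c)) \<in> I"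
      using S \<alpha>\<beta>(1,2) fg(1,2) by (simp add: I.I_l_closed)
    also have "\<alpha> \<otimes> a \<oplus> \<beta> \<otimes> (f \<otimes> (b \<otimes> x) \<oplus> g \<otimes> (b \<otimes> c)) = \<alpha> \<otimes> a \<oplus> \<beta> \<otimes> b \<otimes> (f \<otimes> x \<oplus> g \<otimes> c)"
      using R \<alpha>\<beta>(1,2) fg(1,2) by algebra
    finally show "\<one> \<in> I"
      using \<alpha>\<beta> fg R by simp
  qed (use R in auto)
  then have "A \<in> Um_mats2 R"
    using R by (simp add: A_def Um_mats2_def elements_mat2)
  then obtain N where N: "N \<in> GL R 2" "symmetric_mat (rmat_mult R A N)"
    using assms unfolding WSU2_ring_def by blast
  from N(1) obtain n11 n12 n21 n22 m11 m12 m21 m22 where n: "N = mat2 n11 n12 n21 n22"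
    "n11 \<in> carrier R" "n12 \<in> carrier R" "n21 \<in> carrier R" "n22 \<in> carrier R"
    "m11 \<in> carrier R" "m12 \<in> carrier R" "m21 \<in> carrier R" "m22 \<in> carrier R"
    "n11 \<otimes> m11 \<oplus> n12 \<otimes> m21 = \<one>" "n11 \<otimes> m12 \<oplus> n12 \<otimes> m22 = \<zero>"
    "n21 \<otimes> m11 \<oplus> n22 \<otimes> m21 = \<zero>" "n21 \<otimes> m12 \<oplus> n22 \<otimes> m22 = \<one>"
    using GL2_E by metis
  have "a \<otimes> n12 \<oplus> b \<otimes> x \<otimes> n22 = b \<otimes> c \<otimes> n21"
    using N(2) R n(2-5) unfolding n(1) A_def by (simp add: mat2_mult symmetric_mat2_iff)
  from symmetric_completion_units[OF R \<alpha>\<beta>(1,2) fg(1,2) n(2-9) \<alpha>\<beta>(3) fg(3) n(10-13) this]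
  show "\<exists>u \<in> carrier R. \<exists>v \<in> carrier R. \<exists>t \<in> carrier R.
      comaximal R u (a \<otimes> c) \<and> comaximal R v (b \<otimes> c) \<and> u \<otimes> v = x \<otimes> x \<oplus> c \<otimes> t"
    by metis
qed

lemma square_splittingE:
  assumes "square_splitting R" "a \<in> carrier R" "b \<in> carrier R" "c \<in> carrier R" "x \<in> carrier R"
    "comaximal R a b" "comaximal R x c"
  obtains u v t where "u \<in> carrier R" "v \<in> carrier R" "t \<in> carrier R"
    "comaximal R u (a \<otimes> c)" "comaximal R v (b \<otimes> c)" "u \<otimes> v = x \<otimes> x \<oplus> c \<otimes> t"
proof -
  have "\<exists>u \<in> carrier R. \<exists>v \<in> carrier R. \<exists>t \<in> carrier R.
      comaximal R u (a \<otimes> c) \<and> comaximal R v (b \<otimes> c) \<and> u \<otimes> v = x \<otimes> x \<oplus> c \<otimes> t"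
    using assms(1)[unfolded square_splitting_def, rule_format, OF assms(2-7)] .
  then show ?thesis
    using that by blast
qed

section \<open>Cosets and units modulo a principal ideal\<close>

lemma principal_quot_carrier:
  "U \<in> carrier (principal_quot R c) \<longleftrightarrow> (\<exists>x \<in> carrier R. U = PIdl c +> x)"
  by (auto simp: FactRing_def A_RCOSETS_def')

lemma principal_quot_mult:
  assumes "c \<in> carrier R" "x \<in> carrier R" "y \<in> carrier R"
  shows "(PIdl c +> x) \<otimes>\<^bsub>principal_quot R c\<^esub> (PIdl c +> y) = PIdl c +> (x \<otimes> y)"
  using ideal.rcoset_mult_add[OF cgenideal_ideal[OF assms(1)] assms(2,3)] by (simp add: FactRing_def)

lemma principal_coset_eq_iff:
  assumes "c \<in> carrier R" "x \<in> carrier R" "y \<in> carrier R"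
  shows "PIdl c +> x = PIdl c +> y \<longleftrightarrow> (\<exists>t \<in> carrier R. x = y \<oplus> c \<otimes> t)"
proof -
  have "PIdl c +> x = PIdl c +> y \<longleftrightarrow> x \<ominus> y \<in> PIdl c"
    using quotient_eq_iff_same_a_r_cos[OF cgenideal_ideal[OF assms(1)] assms(2,3)] by auto
  also have "\<dots> \<longleftrightarrow> (\<exists>t \<in> carrier R. x \<ominus> y = t \<otimes> c)"
    unfolding cgenideal_def by auto
  also have "\<dots> \<longleftrightarrow> (\<exists>t \<in> carrier R. x = y \<oplus> c \<otimes> t)"
  proof -
    have "x \<ominus> y = t \<otimes> c \<longleftrightarrow> x = y \<oplus> c \<otimes> t" if t: "t \<in> carrier R" for t
    proof
      assume "x \<ominus> y = t \<otimes> c"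
      then have "y \<oplus> c \<otimes> t = y \<oplus> (x \<ominus> y)" using assms t by (simp add: m_comm)
      also have "\<dots> = x" using assms by algebra
      finally show "x = y \<oplus> c \<otimes> t" by simp
    next
      assume "x = y \<oplus> c \<otimes> t"
      then have "x \<ominus> y = (y \<oplus> c \<otimes> t) \<ominus> y" by simp
      also have "\<dots> = t \<otimes> c" using assms(1,3) t by algebra
      finally show "x \<ominus> y = t \<otimes> c" .
    qed
    then show ?thesis by auto
  qed
  finally show ?thesis .
qed

lemma principal_quot_Units_iff:
  assumes "c \<in> carrier R" "x \<in> carrier R"
  shows "PIdl c +> x \<in> Units (principal_quot R c) \<longleftrightarrow> comaximal R x c"
proof
  assume "PIdl c +> x \<in> Units (principal_quot R c)"
  then obtain Y where "Y \<in> carrier (principal_quot R c)"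
    "Y \<otimes>\<^bsub>principal_quot R c\<^esub> (PIdl c +> x) = \<one>\<^bsub>principal_quot R c\<^esub>"
    unfolding Units_def by auto
  then obtain y where y: "y \<in> carrier R" "PIdl c +> (y \<otimes> x) = PIdl c +> \<one>"
    using assms unfolding principal_quot_carrier
    by (auto simp: principal_quot_mult) (simp add: FactRing_def)
  then obtain t where t: "t \<in> carrier R" "y \<otimes> x = \<one> \<oplus> c \<otimes> t"
    using assms by (auto simp: principal_coset_eq_iff)
  have "y \<otimes> x \<oplus> \<ominus> t \<otimes> c = \<one> \<oplus> c \<otimes> t \<oplus> \<ominus> t \<otimes> c"
    using t by simp
  also have "\<dots> = \<one>"
    using assms t(1) by algebra
  finally show "comaximal R x c"
    by (rule comaximalI) (use y t in auto)
next
  assume "comaximal R x c"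
  then obtain r s where rs: "r \<in> carrier R" "s \<in> carrier R" "r \<otimes> x \<oplus> s \<otimes> c = \<one>"
    by (rule comaximalE)
  have "r \<otimes> x = (r \<otimes> x \<oplus> s \<otimes> c) \<oplus> c \<otimes> \<ominus> s"
    using assms rs(1,2) by algebra
  then have "r \<otimes> x = \<one> \<oplus> c \<otimes> \<ominus> s"
    using rs by simp
  then have "PIdl c +> (r \<otimes> x) = PIdl c +> \<one>"
    using assms rs by (subst principal_coset_eq_iff) auto
  then have "(PIdl c +> r) \<otimes>\<^bsub>principal_quot R c\<^esub> (PIdl c +> x) = \<one>\<^bsub>principal_quot R c\<^esub>"
    "(PIdl c +> x) \<otimes>\<^bsub>principal_quot R c\<^esub> (PIdl c +> r) = \<one>\<^bsub>principal_quot R c\<^esub>"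
    using assms rs(1) m_comm[of x r] by (simp_all add: principal_quot_mult) (simp_all add: FactRing_def)
  moreover have "PIdl c +> x \<in> carrier (principal_quot R c)" "PIdl c +> r \<in> carrier (principal_quot R c)"
    using assms rs(1) by (auto simp: principal_quot_carrier)
  ultimately show "PIdl c +> x \<in> Units (principal_quot R c)"
    unfolding Units_def by blast
qed

lemma principal_quot_Units:
  assumes "c \<in> carrier R"
  shows "Units (principal_quot R c) = {PIdl c +> x | x. x \<in> carrier R \<and> comaximal R x c}"
proof -
  have "Units (principal_quot R c) \<subseteq> carrier (principal_quot R c)"
    unfolding Units_def by auto
  then show ?thesis
    using principal_quot_Units_iff[OF assms] principal_quot_carrier by (auto 0 4)
qed

text \<open>The ideal generated by \<open>a c\<close> is absorbed by the one generated by
  \<open>c\<close>; the reduction therefore acts on representatives as the identity.\<close>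

lemma quot_reduction_coset:
  assumes "a \<in> carrier R" "c \<in> carrier R" "x \<in> carrier R"
  shows "quot_reduction R (PIdl c) (PIdl (a \<otimes> c) +> x) = PIdl c +> x"
proof -
  have "(PIdl (a \<otimes> c) +> x) <+> PIdl c = PIdl c +> x"
  proof (rule Set.set_eqI)
    fix z
    have "z \<in> (PIdl (a \<otimes> c) +> x) <+> PIdl c \<longleftrightarrow>
        (\<exists>s \<in> carrier R. \<exists>t \<in> carrier R. z = (s \<otimes> (a \<otimes> c) \<oplus> x) \<oplus> t \<otimes> c)"
      unfolding set_add_def' a_r_coset_def' cgenideal_def by blast
    also have "\<dots> \<longleftrightarrow> (\<exists>t \<in> carrier R. z = t \<otimes> c \<oplus> x)"
    proof
      assume "\<exists>s \<in> carrier R. \<exists>t \<in> carrier R. z = (s \<otimes> (a \<otimes> c) \<oplus> x) \<oplus> t \<otimes> c"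
      then obtain s t where st: "s \<in> carrier R" "t \<in> carrier R" "z = (s \<otimes> (a \<otimes> c) \<oplus> x) \<oplus> t \<otimes> c"
        by blast
      have "(s \<otimes> (a \<otimes> c) \<oplus> x) \<oplus> t \<otimes> c = (s \<otimes> a \<oplus> t) \<otimes> c \<oplus> x"
        using assms st(1,2) by algebra
      then show "\<exists>t \<in> carrier R. z = t \<otimes> c \<oplus> x"
        using assms st by (intro bexI[of _ "s \<otimes> a \<oplus> t"]) auto
    next
      assume "\<exists>t \<in> carrier R. z = t \<otimes> c \<oplus> x"
      then obtain t where "t \<in> carrier R" "z = t \<otimes> c \<oplus> x" by blast
      then have "z = (\<zero> \<otimes> (a \<otimes> c) \<oplus> x) \<oplus> t \<otimes> c"
        using assms by (simp add: a_comm)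
      then show "\<exists>s \<in> carrier R. \<exists>t \<in> carrier R. z = (s \<otimes> (a \<otimes> c) \<oplus> x) \<oplus> t \<otimes> c"
        using \<open>t \<in> carrier R\<close> by blast
    qed
    also have "\<dots> \<longleftrightarrow> z \<in> PIdl c +> x"
      unfolding a_r_coset_def' cgenideal_def by blast
    finally show "z \<in> (PIdl (a \<otimes> c) +> x) <+> PIdl c \<longleftrightarrow> z \<in> PIdl c +> x" .
  qed
  then show ?thesis by (simp add: quot_reduction_def)
qed

text \<open>The bridge from the coset definition to representatives: afterwards both unit properties
  are statements about comaximal elements of the ring.\<close>

lemma unit_product_image_eq:
  assumes "a \<in> carrier R" "b \<in> carrier R" "c \<in> carrier R"
  shows "unit_product_image R a b c = {PIdl c +> (u \<otimes> v) | u v.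
     u \<in> carrier R \<and> v \<in> carrier R \<and> comaximal R u (a \<otimes> c) \<and> comaximal R v (b \<otimes> c)}"
proof -
  have map: "unit_product_map R c (PIdl (a \<otimes> c) +> u, PIdl (b \<otimes> c) +> v) = PIdl c +> (u \<otimes> v)"
    if "u \<in> carrier R" "v \<in> carrier R" for u v
    using that assms by (simp add: unit_product_map_def quot_reduction_coset principal_quot_mult)
  show ?thesis (is "_ = ?rhs")
  proof
    show "unit_product_image R a b c \<subseteq> ?rhs"
      unfolding unit_product_image_def using assms
      by (auto simp: principal_quot_Units map) blast
    show "?rhs \<subseteq> unit_product_image R a b c"
    proof
      fix U assume "U \<in> ?rhs"
      then obtain u v where uv: "u \<in> carrier R" "v \<in> carrier R"
        "comaximal R u (a \<otimes> c)" "comaximal R v (b \<otimes> c)" "U = PIdl c +> (u \<otimes> v)"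
        by blast
      have "U = unit_product_map R c (PIdl (a \<otimes> c) +> u, PIdl (b \<otimes> c) +> v)"
        using map uv by simp
      then show "U \<in> unit_product_image R a b c"
        unfolding unit_product_image_def using uv assms
        by (intro image_eqI) (auto simp: principal_quot_Units_iff)
    qed
  qed
qed

lemma square_coset_in_unit_product_image:
  assumes "square_splitting R" "a \<in> carrier R" "b \<in> carrier R" "c \<in> carrier R" "x \<in> carrier R"
    "comaximal R a b" "comaximal R x c"
  shows "PIdl c +> (x \<otimes> x) \<in> unit_product_image R a b c"
proof -
  obtain u v t where uvt: "u \<in> carrier R" "v \<in> carrier R" "t \<in> carrier R"
    "comaximal R u (a \<otimes> c)" "comaximal R v (b \<otimes> c)" "u \<otimes> v = x \<otimes> x \<oplus> c \<otimes> t"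
    using assms by (rule square_splittingE)
  then have "PIdl c +> (u \<otimes> v) = PIdl c +> (x \<otimes> x)"
    using assms by (subst principal_coset_eq_iff) auto
  then show ?thesis
    unfolding unit_product_image_eq[OF assms(2-4)] using uvt by blast
qed

section \<open>From splitting of squares to the two unit properties\<close>

lemma WU2_if_square_splitting:
  assumes "square_splitting R"
  shows "WU2_ring R"
  unfolding WU2_ring_def
proof (clarify)
  fix a b c U
  assume ab: "(a, b) \<in> Um_pairs R" and c: "c \<in> carrier R"
    and U: "U \<in> Units (principal_quot R c)"
  have ab: "a \<in> carrier R" "b \<in> carrier R" "comaximal R a b"
    using ab comaximal_if_Idl by (auto simp: Um_pairs_def)
  obtain x where x: "x \<in> carrier R" "comaximal R x c" "U = PIdl c +> x"
    using U c by (auto simp: principal_quot_Units)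
  interpret Q: ring "principal_quot R c"
    using c by (intro ideal.quotient_is_ring cgenideal_ideal)
  have "U \<in> carrier (principal_quot R c)"
    using U by auto
  then have "U [^]\<^bsub>principal_quot R c\<^esub> (2::nat) = PIdl c +> (x \<otimes> x)"
    using x c by (simp add: numeral_2_eq_2 principal_quot_mult)
  then show "U [^]\<^bsub>principal_quot R c\<^esub> (2::nat) \<in> unit_product_image R a b c"
    using square_coset_in_unit_product_image[OF assms ab(1,2) c x(1) ab(3) x(2)] by simp
qed

lemma all_squaresE:
  assumes "all_squares R" "x \<in> carrier R"
  obtains y where "y \<in> carrier R" "x = y \<otimes> y"
proof -
  obtain y where "y \<in> carrier R" "x = y [^] (2::nat)"
    using assms unfolding all_squares_def by blast
  then show ?thesis
    by (intro that[of y]) (simp_all add: numeral_2_eq_2)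
qed

lemma U2_if_square_splitting:
  assumes "square_splitting R" "all_squares R"
  shows "U2_ring R"
  unfolding U2_ring_def
proof (clarify)
  fix a b c
  assume "(a, b) \<in> Um_pairs R" and c: "c \<in> carrier R"
  then have ab: "a \<in> carrier R" "b \<in> carrier R" "comaximal R a b"
    using comaximal_if_Idl by (auto simp: Um_pairs_def)
  show "unit_product_image R a b c = Units (principal_quot R c)"
  proof (rule Set.set_eqI, rule iffI)
    \<comment> \<open>\<open>U2_ring\<close> asks for an equality of sets, so it also has to be seen
      that the products are units modulo \<open>c\<close>.\<close>
    fix U assume "U \<in> unit_product_image R a b c"
    then obtain u v where uv: "u \<in> carrier R" "v \<in> carrier R"
      "comaximal R u (a \<otimes> c)" "comaximal R v (b \<otimes> c)" "U = PIdl c +> (u \<otimes> v)"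
      unfolding unit_product_image_eq[OF ab(1,2) c] by blast
    then have "comaximal R (u \<otimes> v) c"
      using ab c comaximal_factor(2) by (intro comaximal_mult_left) blast+
    then show "U \<in> Units (principal_quot R c)"
      using uv c by (simp add: principal_quot_Units_iff)
  next
    fix U assume "U \<in> Units (principal_quot R c)"
    then obtain x where x: "x \<in> carrier R" "comaximal R x c" "U = PIdl c +> x"
      using c by (auto simp: principal_quot_Units)
    obtain y where y: "y \<in> carrier R" "x = y \<otimes> y"
      using assms(2) x(1) by (rule all_squaresE)
    \<comment> \<open>A square root of a unit modulo \<open>c\<close> is a factor of that unit,
      hence a unit itself, so \<open>y\<close> is admissible for the splitting.\<close>
    have "comaximal R c (y \<otimes> y)"
      using comaximal_sym[OF x(2,1) c] y(2) by simp
    then have "comaximal R c y"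
      using c y(1) y(1) by (rule comaximal_factor(1))
    then have "comaximal R y c"
      using c y(1) by (rule comaximal_sym)
    then show "U \<in> unit_product_image R a b c"
      using square_coset_in_unit_product_image[OF assms(1) ab(1,2) c y(1) ab(3)] x y by simp
  qed
qed

end

section \<open>Hermite rings and triangular matrices\<close>

text \<open>Kaplansky's Hermite condition, in the form obtained from \<open>(a b) N = (d 0)\<close>
  by multiplying with the inverse of \<open>N\<close>. The common divisor \<open>d\<close> does not
  determine the cofactors, so their comaximality is part of the condition.\<close>

definition hermite_ring :: "('a, 'm) ring_scheme \<Rightarrow> bool" where
  "hermite_ring R \<longleftrightarrow> (\<forall>a \<in> carrier R. \<forall>b \<in> carrier R.
     \<exists>d \<in> carrier R. \<exists>a' \<in> carrier R. \<exists>b' \<in> carrier R.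
       a = d \<otimes>\<^bsub>R\<^esub> a' \<and> b = d \<otimes>\<^bsub>R\<^esub> b' \<and> comaximal R a' b')"

text \<open>The family \<open>C\<close> witnesses that the entries of \<open>A\<close> generate the
  unit ideal; the conclusion is \<open>p A q = 1\<close>. Functions instead of matrices allow rows
  to be dropped and recombined without changing dimensions.\<close>

definition attains_one :: "('a, 'm) ring_scheme \<Rightarrow> nat \<Rightarrow> nat \<Rightarrow> bool" where
  "attains_one R m n \<longleftrightarrow> (\<forall>A C.
     (\<forall>i<m. \<forall>j<n. A i j \<in> carrier R \<and> C i j \<in> carrier R) \<longrightarrow>
     (\<Oplus>\<^bsub>R\<^esub>i\<in>{..<m}. \<Oplus>\<^bsub>R\<^esub>j\<in>{..<n}. C i j \<otimes>\<^bsub>R\<^esub> A i j) = \<one>\<^bsub>R\<^esub> \<longrightarrow>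
     (\<exists>p q. (\<forall>i<m. p i \<in> carrier R) \<and> (\<forall>j<n. q j \<in> carrier R) \<and>
        (\<Oplus>\<^bsub>R\<^esub>j\<in>{..<n}. (\<Oplus>\<^bsub>R\<^esub>i\<in>{..<m}. p i \<otimes>\<^bsub>R\<^esub> A i j) \<otimes>\<^bsub>R\<^esub> q j) = \<one>\<^bsub>R\<^esub>))"

context cring
begin

lemma hermiteE:
  assumes "hermite_ring R" "a \<in> carrier R" "b \<in> carrier R"
  obtains d a' b' r s where "d \<in> carrier R" "a' \<in> carrier R" "b' \<in> carrier R"
    "r \<in> carrier R" "s \<in> carrier R" "a = d \<otimes> a'" "b = d \<otimes> b'" "r \<otimes> a' \<oplus> s \<otimes> b' = \<one>"
proof -
  obtain d a' b' where "d \<in> carrier R" "a' \<in> carrier R" "b' \<in> carrier R"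
    "a = d \<otimes> a'" "b = d \<otimes> b'" "comaximal R a' b'"
    using assms(1)[unfolded hermite_ring_def, rule_format, OF assms(2,3)] by blast
  then show ?thesis
    using that by (elim comaximalE) simp
qed

text \<open>Put the row \<open>(a b)\<close> over a zero row. The lower left entry of the product
  with \<open>N\<close> is zero, so symmetry gives \<open>(a b) N = (d 0)\<close>, and
  \<open>(a b)\<close> is \<open>d\<close> times the first row of the inverse of \<open>N\<close>, a
  unimodular row.\<close>

lemma hermite_if_SU2:
  assumes "SU2_ring R"
  shows "hermite_ring R"
  unfolding hermite_ring_def
proof (intro ballI)
  fix a b assume ab: "a \<in> carrier R" "b \<in> carrier R"
  then have "mat2 a b \<zero> \<zero> \<in> ring_mats R 2 2"
    by simp
  then obtain N where N: "N \<in> GL R 2" "symmetric_mat (rmat_mult R (mat2 a b \<zero> \<zero>) N)"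
    using assms unfolding SU2_ring_def by blast
  from N(1) obtain n11 n12 n21 n22 m11 m12 m21 m22 where n: "N = mat2 n11 n12 n21 n22"
    "n11 \<in> carrier R" "n12 \<in> carrier R" "n21 \<in> carrier R" "n22 \<in> carrier R"
    "m11 \<in> carrier R" "m12 \<in> carrier R" "m21 \<in> carrier R" "m22 \<in> carrier R"
    "n11 \<otimes> m11 \<oplus> n12 \<otimes> m21 = \<one>" "n11 \<otimes> m12 \<oplus> n12 \<otimes> m22 = \<zero>"
    "n21 \<otimes> m11 \<oplus> n22 \<otimes> m21 = \<zero>" "n21 \<otimes> m12 \<oplus> n22 \<otimes> m22 = \<one>"
    "m11 \<otimes> n11 \<oplus> m12 \<otimes> n21 = \<one>"
    by (rule GL2_E)
  have sym: "a \<otimes> n12 \<oplus> b \<otimes> n22 = \<zero>"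
    using N(2) ab n(2-5) unfolding n(1) by (simp add: mat2_mult symmetric_mat2_iff)
  define d where "d = a \<otimes> n11 \<oplus> b \<otimes> n21"
  have "d \<otimes> m11 \<oplus> (a \<otimes> n12 \<oplus> b \<otimes> n22) \<otimes> m21
      = a \<otimes> (n11 \<otimes> m11 \<oplus> n12 \<otimes> m21) \<oplus> b \<otimes> (n21 \<otimes> m11 \<oplus> n22 \<otimes> m21)"
    "d \<otimes> m12 \<oplus> (a \<otimes> n12 \<oplus> b \<otimes> n22) \<otimes> m22
      = a \<otimes> (n11 \<otimes> m12 \<oplus> n12 \<otimes> m22) \<oplus> b \<otimes> (n21 \<otimes> m12 \<oplus> n22 \<otimes> m22)"
    unfolding d_def using ab n(2-9) by algebra+
  moreover have d: "d \<in> carrier R"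
    using ab n(2-9) by (simp add: d_def)
  ultimately have "a = d \<otimes> m11" "b = d \<otimes> m12"
    using ab n sym by simp_all
  moreover have "comaximal R m11 m12"
    using n(2-9,14) by (intro comaximalI[of n11 _ n21]) (simp_all add: m_comm)
  ultimately show "\<exists>d \<in> carrier R. \<exists>a' \<in> carrier R. \<exists>b' \<in> carrier R.
      a = d \<otimes> a' \<and> b = d \<otimes> b' \<and> comaximal R a' b'"
    using d n(6,7) by blast
qed

text \<open>Write \<open>(x, y) = e (x', y')\<close> and turn the Bezout vector of
  \<open>(x', y')\<close> into \<open>(-\<beta>, \<alpha>)\<close>. These two rows form a matrix of
  determinant 1, and the row \<open>(e, z)\<close> is unimodular, so
  \<open>e (x', y') + z (-\<beta>, \<alpha>)\<close> is unimodular as well.\<close>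

lemma hermite_stable_range:
  assumes "hermite_ring R" "x \<in> carrier R" "y \<in> carrier R" "z \<in> carrier R"
    "k1 \<in> carrier R" "k2 \<in> carrier R" "k3 \<in> carrier R"
    "k1 \<otimes> x \<oplus> k2 \<otimes> y \<oplus> k3 \<otimes> z = \<one>"
  obtains s r where "s \<in> carrier R" "r \<in> carrier R" "comaximal R (x \<oplus> z \<otimes> s) (y \<oplus> z \<otimes> r)"
proof -
  obtain e x' y' \<alpha> \<beta> where e: "e \<in> carrier R" "x' \<in> carrier R" "y' \<in> carrier R"
    "\<alpha> \<in> carrier R" "\<beta> \<in> carrier R" "x = e \<otimes> x'" "y = e \<otimes> y'" "\<alpha> \<otimes> x' \<oplus> \<beta> \<otimes> y' = \<one>"
    using assms(1-3) by (rule hermiteE)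
  define l where "l = k1 \<otimes> x' \<oplus> k2 \<otimes> y'"
  have l: "l \<in> carrier R" using assms e by (simp add: l_def)
  have le: "l \<otimes> e \<oplus> k3 \<otimes> z = \<one>"
  proof -
    have "l \<otimes> e \<oplus> k3 \<otimes> z = k1 \<otimes> (e \<otimes> x') \<oplus> k2 \<otimes> (e \<otimes> y') \<oplus> k3 \<otimes> z"
      unfolding l_def using assms(4-7) e(1-3) by algebra
    then show ?thesis using assms(8) e(6,7) by simp
  qed
  have "comaximal R (x \<oplus> z \<otimes> \<ominus> \<beta>) (y \<oplus> z \<otimes> \<alpha>)"
  proof (rule comaximalI)
    \<comment> \<open>The coefficients are the inverse of that matrix applied to the column
      \<open>(l, k3)\<close>.\<close>
    have "(l \<otimes> \<alpha> \<ominus> k3 \<otimes> y') \<otimes> (x \<oplus> z \<otimes> \<ominus> \<beta>) \<oplus> (l \<otimes> \<beta> \<oplus> k3 \<otimes> x') \<otimes> (y \<oplus> z \<otimes> \<alpha>)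
        = (l \<otimes> e \<oplus> k3 \<otimes> z) \<otimes> (\<alpha> \<otimes> x' \<oplus> \<beta> \<otimes> y')"
      unfolding e(6,7) using assms(4,7) l e(1-5) by algebra
    then show "(l \<otimes> \<alpha> \<ominus> k3 \<otimes> y') \<otimes> (x \<oplus> z \<otimes> \<ominus> \<beta>) \<oplus> (l \<otimes> \<beta> \<oplus> k3 \<otimes> x') \<otimes> (y \<oplus> z \<otimes> \<alpha>) = \<one>"
      using le e(8) by simp
  qed (use assms(7) l e(1-5) in auto)
  then show ?thesis
    using that e(4,5) by blast
qed

text \<open>The row \<open>(p q)\<close> times \<open>((a, b), (0, c))\<close> is
  \<open>(p a, p b + q c)\<close>. Its second entry has to be a unit modulo \<open>a\<close> and
  modulo \<open>p\<close>. The splitting of \<open>b\<close> settles the first condition, the stable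
  range the second.\<close>

lemma triangular_attains_one:
  assumes split: "square_splitting R" and sq: "all_squares R" and H: "hermite_ring R"
    and R: "a \<in> carrier R" "b \<in> carrier R" "c \<in> carrier R"
      "k1 \<in> carrier R" "k2 \<in> carrier R" "k3 \<in> carrier R"
    and k: "k1 \<otimes> a \<oplus> k2 \<otimes> b \<oplus> k3 \<otimes> c = \<one>"
  obtains p q e f where "p \<in> carrier R" "q \<in> carrier R" "e \<in> carrier R" "f \<in> carrier R"
    "e \<otimes> (p \<otimes> a) \<oplus> f \<otimes> (p \<otimes> b \<oplus> q \<otimes> c) = \<one>"
proof -
  obtain d a' c' \<alpha> \<gamma> where d: "d \<in> carrier R" "a' \<in> carrier R" "c' \<in> carrier R"
    "\<alpha> \<in> carrier R" "\<gamma> \<in> carrier R" "a = d \<otimes> a'" "c = d \<otimes> c'" "\<alpha> \<otimes> a' \<oplus> \<gamma> \<otimes> c' = \<one>"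
    using H R(1,3) by (rule hermiteE)
  have a'd: "a' \<otimes> d = a" "c' \<otimes> d = c"
    using d by (simp_all add: m_comm)
  have deq: "d = \<alpha> \<otimes> a \<oplus> \<gamma> \<otimes> c"
  proof -
    have "\<alpha> \<otimes> (d \<otimes> a') \<oplus> \<gamma> \<otimes> (d \<otimes> c') = d \<otimes> (\<alpha> \<otimes> a' \<oplus> \<gamma> \<otimes> c')"
      using d(1-5) by algebra
    then show ?thesis using d by simp
  qed
  have a'c': "comaximal R a' c'"
    using d by (intro comaximalI)
  have db: "comaximal R d b"
  proof (rule comaximalI)
    have "(k1 \<otimes> a' \<oplus> k3 \<otimes> c') \<otimes> d \<oplus> k2 \<otimes> b = k1 \<otimes> (d \<otimes> a') \<oplus> k2 \<otimes> b \<oplus> k3 \<otimes> (d \<otimes> c')"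
      using R(2,4-6) d(1-3) by algebra
    then show "(k1 \<otimes> a' \<oplus> k3 \<otimes> c') \<otimes> d \<oplus> k2 \<otimes> b = \<one>"
      using k d(6,7) by simp
  qed (use R d(2,3) in auto)
  \<comment> \<open>Only squares can be split, so \<open>b\<close> enters through a square root,
    which is still a unit modulo \<open>d\<close>.\<close>
  obtain y where y: "y \<in> carrier R" "b = y \<otimes> y"
    using sq R(2) by (rule all_squaresE)
  have "comaximal R d y"
    using db[unfolded y(2)] d(1) y(1) y(1) by (rule comaximal_factor(1))
  then have yd: "comaximal R y d"
    using d(1) y(1) by (rule comaximal_sym)
  obtain u v t where u: "u \<in> carrier R" "v \<in> carrier R" "t \<in> carrier R"
    "comaximal R u (a' \<otimes> d)" "comaximal R v (c' \<otimes> d)" "u \<otimes> v = y \<otimes> y \<oplus> d \<otimes> t"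
    using split d(2,3,1) y(1) a'c' yd by (rule square_splittingE)
  have ua: "comaximal R u a" and vc: "comaximal R v c"
    using u(4,5) by (simp_all only: a'd)
  have uv: "u \<otimes> v = b \<oplus> (\<alpha> \<otimes> a \<oplus> \<gamma> \<otimes> c) \<otimes> t"
    using u(6) by (simp only: y(2) deq)
  obtain g h where gh: "g \<in> carrier R" "h \<in> carrier R" "g \<otimes> u \<oplus> h \<otimes> a = \<one>"
    using ua by (rule comaximalE)
  obtain p q' where p: "p \<in> carrier R" "q' \<in> carrier R" "p \<otimes> v \<oplus> q' \<otimes> c = \<one>"
    using vc by (rule comaximalE)
  \<comment> \<open>Chosen so that \<open>p b + q c\<close> becomes \<open>u\<close> modulo
    \<open>a\<close>: the first summand completes \<open>u p v\<close> to \<open>u\<close>, and the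
    second cancels the \<open>c\<close> part of the error term \<open>p d t\<close>, where
    \<open>d = \<alpha> a + \<gamma> c\<close>.\<close>
  define q where "q = u \<otimes> q' \<oplus> t \<otimes> \<gamma> \<otimes> p"
  have q: "q \<in> carrier R"
    using u p d by (simp add: q_def)
  have pq: "p \<otimes> b \<oplus> q \<otimes> c = u \<ominus> a \<otimes> (p \<otimes> t \<otimes> \<alpha>)"
  proof -
    have "p \<otimes> b \<oplus> q \<otimes> c = p \<otimes> (b \<oplus> (\<alpha> \<otimes> a \<oplus> \<gamma> \<otimes> c) \<otimes> t) \<oplus> u \<otimes> (q' \<otimes> c) \<ominus> a \<otimes> (p \<otimes> t \<otimes> \<alpha>)"
      unfolding q_def using R u(1-3) p(1,2) d(4,5) by algebra
    also have "\<dots> = p \<otimes> (u \<otimes> v) \<oplus> u \<otimes> (q' \<otimes> c) \<ominus> a \<otimes> (p \<otimes> t \<otimes> \<alpha>)"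
      by (simp only: uv)
    also have "\<dots> = u \<otimes> (p \<otimes> v \<oplus> q' \<otimes> c) \<ominus> a \<otimes> (p \<otimes> t \<otimes> \<alpha>)"
      using R u(1-3) p(1,2) d(4) by algebra
    finally show ?thesis
      using u(1) p(3) by simp
  qed
  define l1 where "l1 = g \<otimes> (u \<otimes> v \<ominus> c \<otimes> t \<otimes> \<gamma>) \<oplus> h \<otimes> a \<otimes> v"
  have l1: "l1 \<in> carrier R"
    using R u(1-3) gh(1,2) d(5) by (simp add: l1_def)
  \<comment> \<open>Modulo \<open>p\<close> and \<open>q\<close> one has \<open>q' c = 1\<close> and
    \<open>u = q c = 0\<close>, hence also \<open>h a = 1\<close>; so \<open>a c\<close> is a unit
    there. Expanding the product of the two Bezout relations gives the coefficients.\<close>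
  have "l1 \<otimes> p \<oplus> (g \<otimes> c) \<otimes> q \<oplus> (h \<otimes> q') \<otimes> (a \<otimes> c) = (g \<otimes> u \<oplus> h \<otimes> a) \<otimes> (p \<otimes> v \<oplus> q' \<otimes> c)"
    unfolding l1_def q_def using R u(1-3) gh(1,2) p(1,2) d(5) by algebra
  also have "\<dots> = \<one>"
    using gh(3) p(3) by simp
  finally have "l1 \<otimes> p \<oplus> (g \<otimes> c) \<otimes> q \<oplus> (h \<otimes> q') \<otimes> (a \<otimes> c) = \<one>" .
  then obtain s r where sr: "s \<in> carrier R" "r \<in> carrier R"
    "comaximal R (p \<oplus> a \<otimes> c \<otimes> s) (q \<oplus> a \<otimes> c \<otimes> r)"
    using hermite_stable_range[OF H p(1) q, of "a \<otimes> c" l1 "g \<otimes> c" "h \<otimes> q'"] l1 R gh(1,2) p(2) by auto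
  define P where "P = p \<oplus> a \<otimes> c \<otimes> s"
  define Q where "Q = q \<oplus> a \<otimes> c \<otimes> r"
  have PQ: "P \<in> carrier R" "Q \<in> carrier R" "comaximal R P Q"
    using sr R p(1) q by (simp_all add: P_def Q_def)
  \<comment> \<open>Since \<open>P\<close> agrees with \<open>p\<close> modulo \<open>c\<close>, it
    stays comaximal with \<open>c\<close>. Being comaximal with \<open>Q\<close> too, it is
    comaximal with \<open>Q c\<close> and so with \<open>P b + Q c\<close>.\<close>
  have "comaximal R p c"
    using p u(2) R(3) by (intro comaximalI[of v _ q']) (simp_all add: m_comm)
  then have "comaximal R (p \<oplus> c \<otimes> (a \<otimes> s)) c"
    using p(1) R sr by (intro comaximal_add_mult) auto
  also have "p \<oplus> c \<otimes> (a \<otimes> s) = P"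
    using p(1) R sr by (simp add: P_def m_ac)
  finally have "comaximal R P (Q \<otimes> c)"
    using PQ R(3) by (intro comaximal_mult)
  then have "comaximal R (Q \<otimes> c) P"
    by (rule comaximal_sym) (use PQ R(3) in auto)
  then have "comaximal R (Q \<otimes> c \<oplus> P \<otimes> b) P"
    using PQ R by (intro comaximal_add_mult) auto
  also have "Q \<otimes> c \<oplus> P \<otimes> b = P \<otimes> b \<oplus> Q \<otimes> c"
    using PQ R by (simp add: a_comm)
  finally have 1: "comaximal R (P \<otimes> b \<oplus> Q \<otimes> c) P" .
  define w where "w = c \<otimes> s \<otimes> b \<oplus> c \<otimes> r \<otimes> c \<ominus> p \<otimes> t \<otimes> \<alpha>"
  have w: "w \<in> carrier R"
    using R sr p(1) u(3) d(4) by (simp add: w_def)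
  \<comment> \<open>Multiples of \<open>a c\<close> added to \<open>p\<close> and \<open>q\<close>
    change \<open>p b + q c\<close> by a multiple of \<open>a\<close>, so the residue
    \<open>u\<close> modulo \<open>a\<close> survives.\<close>
  have "P \<otimes> b \<oplus> Q \<otimes> c = (p \<otimes> b \<oplus> q \<otimes> c) \<oplus> a \<otimes> (c \<otimes> s \<otimes> b \<oplus> c \<otimes> r \<otimes> c)"
    unfolding P_def Q_def using R sr(1,2) p(1) q by algebra
  also have "\<dots> = u \<oplus> a \<otimes> w"
    unfolding pq w_def using R sr(1,2) p(1) u(1,3) d(4) by algebra
  finally have "comaximal R (P \<otimes> b \<oplus> Q \<otimes> c) a"
    using comaximal_add_mult[OF ua u(1) R(1) w] by simp
  with 1 have "comaximal R (P \<otimes> b \<oplus> Q \<otimes> c) (P \<otimes> a)"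
    using PQ R by (intro comaximal_mult) auto
  then have "comaximal R (P \<otimes> a) (P \<otimes> b \<oplus> Q \<otimes> c)"
    by (rule comaximal_sym) (use PQ R in auto)
  then obtain e f where "e \<in> carrier R" "f \<in> carrier R" "e \<otimes> (P \<otimes> a) \<oplus> f \<otimes> (P \<otimes> b \<oplus> Q \<otimes> c) = \<one>"
    by (rule comaximalE)
  then show ?thesis
    using that PQ by blast
qed

text \<open>A column operation of determinant 1 makes the matrix upper triangular. It preserves
  unimodularity, and a column found for the triangular matrix can be carried back.\<close>

lemma attains_one_2_2:
  assumes "square_splitting R" "all_squares R" and H: "hermite_ring R"
  shows "attains_one R 2 2"
  unfolding attains_one_def
proof (intro allI impI)
  fix A C :: "nat \<Rightarrow> nat \<Rightarrow> 'a"
  assume R: "\<forall>i<2. \<forall>j<2. A i j \<in> carrier R \<and> C i j \<in> carrier R"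
    and one: "(\<Oplus>i\<in>{..<2}. \<Oplus>j\<in>{..<2}. C i j \<otimes> A i j) = \<one>"
  define p q r s where "p = A 0 0" "q = A 0 1" "r = A 1 0" "s = A 1 1"
  define c1 c2 c3 c4 where "c1 = C 0 0" "c2 = C 0 1" "c3 = C 1 0" "c4 = C 1 1"
  note defs = p_q_r_s_def c1_c2_c3_c4_def
  have cl: "p \<in> carrier R" "q \<in> carrier R" "r \<in> carrier R" "s \<in> carrier R"
    "c1 \<in> carrier R" "c2 \<in> carrier R" "c3 \<in> carrier R" "c4 \<in> carrier R"
    using R by (simp_all add: defs)
  have "(\<Oplus>i\<in>{..<2}. \<Oplus>j\<in>{..<2}. C i j \<otimes> A i j) = (c1 \<otimes> p \<oplus> c2 \<otimes> q) \<oplus> (c3 \<otimes> r \<oplus> c4 \<otimes> s)"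
    using cl unfolding defs by (simp add: finsum_lessThan_two)
  with one have one: "(c1 \<otimes> p \<oplus> c2 \<otimes> q) \<oplus> (c3 \<otimes> r \<oplus> c4 \<otimes> s) = \<one>" by simp
  obtain d r' s' \<alpha> \<beta> where d: "d \<in> carrier R" "r' \<in> carrier R" "s' \<in> carrier R"
    "\<alpha> \<in> carrier R" "\<beta> \<in> carrier R" "r = d \<otimes> r'" "s = d \<otimes> s'" "\<alpha> \<otimes> r' \<oplus> \<beta> \<otimes> s' = \<one>"
    using H cl(3,4) by (rule hermiteE)
  \<comment> \<open>The columns \<open>(s', -r')\<close> and \<open>(\<alpha>, \<beta>)\<close> form
    the operation; it sends the second row to \<open>(0, d)\<close> and the first row to
    \<open>(a, b)\<close>.\<close>
  define a where "a = p \<otimes> s' \<ominus> q \<otimes> r'"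
  define b where "b = p \<otimes> \<alpha> \<oplus> q \<otimes> \<beta>"
  have ab: "a \<in> carrier R" "b \<in> carrier R"
    using cl d by (simp_all add: a_def b_def)
  have "(c1 \<otimes> \<beta> \<ominus> c2 \<otimes> \<alpha>) \<otimes> a \<oplus> (c1 \<otimes> r' \<oplus> c2 \<otimes> s') \<otimes> b \<oplus> (c3 \<otimes> r' \<oplus> c4 \<otimes> s') \<otimes> d
     = (c1 \<otimes> p \<oplus> c2 \<otimes> q) \<otimes> (\<alpha> \<otimes> r' \<oplus> \<beta> \<otimes> s') \<oplus> (c3 \<otimes> (d \<otimes> r') \<oplus> c4 \<otimes> (d \<otimes> s'))"
    unfolding a_def b_def using cl d(1-5) by algebra
  also have "\<dots> = \<one>"
    using one cl d(6-8) by simp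
  finally obtain x1 x2 e f where x: "x1 \<in> carrier R" "x2 \<in> carrier R" "e \<in> carrier R" "f \<in> carrier R"
    "e \<otimes> (x1 \<otimes> a) \<oplus> f \<otimes> (x1 \<otimes> b \<oplus> x2 \<otimes> d) = \<one>"
    using triangular_attains_one[OF assms ab d(1)] cl d(1-5) by (metis add.m_closed m_closed minus_closed)
  define P where "P i = (if i = 0 then x1 else x2)" for i :: nat
  \<comment> \<open>The column operation applied to the column \<open>(e, f)\<close>.\<close>
  define Q where "Q i = (if i = 0 then s' \<otimes> e \<oplus> \<alpha> \<otimes> f else \<beta> \<otimes> f \<ominus> r' \<otimes> e)" for i :: nat
  have "(\<Oplus>j\<in>{..<2}. (\<Oplus>i\<in>{..<2}. P i \<otimes> A i j) \<otimes> Q j)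
      = (x1 \<otimes> p \<oplus> x2 \<otimes> r) \<otimes> (s' \<otimes> e \<oplus> \<alpha> \<otimes> f) \<oplus> (x1 \<otimes> q \<oplus> x2 \<otimes> s) \<otimes> (\<beta> \<otimes> f \<ominus> r' \<otimes> e)"
    using cl x(1-4) d(1-5) unfolding defs by (simp add: finsum_lessThan_two P_def Q_def)
  also have "\<dots> = e \<otimes> (x1 \<otimes> a) \<oplus> f \<otimes> (x1 \<otimes> b \<oplus> x2 \<otimes> (d \<otimes> (\<alpha> \<otimes> r' \<oplus> \<beta> \<otimes> s')))"
    unfolding a_def b_def d(6,7) using cl(1,2) d(1-5) x(1-4) by algebra
  also have "\<dots> = \<one>"
    using x(5) d by simp
  finally show "\<exists>p q. (\<forall>i<2. p i \<in> carrier R) \<and> (\<forall>j<2. q j \<in> carrier R) \<and>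
      (\<Oplus>j\<in>{..<2}. (\<Oplus>i\<in>{..<2}. p i \<otimes> A i j) \<otimes> q j) = \<one>"
    using x(1-4) d(1-5) by (intro exI[of _ P] exI[of _ Q]) (simp add: P_def Q_def)
qed

end

section \<open>Unimodular matrices of arbitrary size\<close>

context cring
begin

text \<open>The common divisor \<open>e\<close> of the first \<open>n\<close> entries is combined
  with the next entry. The old cofactors are multiplied by \<open>x\<close> and their coefficients
  by \<open>r\<close>, so the old sum contributes \<open>r x\<close> and the new entry
  \<open>s y\<close>.\<close>

lemma hermite_vector:
  fixes a :: "nat \<Rightarrow> 'a"
  assumes H: "hermite_ring R" and n: "n \<ge> 1" and a: "\<forall>i<n. a i \<in> carrier R"
  shows "\<exists>d a' c. d \<in> carrier R \<and>
    (\<forall>i<n. a' i \<in> carrier R \<and> c i \<in> carrier R \<and> a i = d \<otimes> a' i) \<and>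
    (\<Oplus>i\<in>{..<n}. c i \<otimes> a' i) = \<one>"
  using n a
proof (induction n rule: dec_induct)
    case base
    then have "(\<Oplus>i\<in>{..<1::nat}. \<one> \<otimes> \<one>) = \<one>"
      using finsum_lessThan_single[of 0 1 "\<lambda>_. \<one> \<otimes> \<one>"] by simp
    then show ?case
      using base by (intro exI[of _ "a 0"] exI[of _ "\<lambda>_. \<one>"]) auto
  next
    case (step n)
    then obtain e a' c where e: "e \<in> carrier R"
      "\<forall>i<n. a' i \<in> carrier R \<and> c i \<in> carrier R \<and> a i = e \<otimes> a' i"
      "(\<Oplus>i\<in>{..<n}. c i \<otimes> a' i) = \<one>"
      using step.IH step.prems by auto
    have "a n \<in> carrier R"
      using step by simp
    with H e(1) obtain d x y r s where d: "d \<in> carrier R" "x \<in> carrier R" "y \<in> carrier R"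
      "r \<in> carrier R" "s \<in> carrier R" "e = d \<otimes> x" "a n = d \<otimes> y" "r \<otimes> x \<oplus> s \<otimes> y = \<one>"
      by (rule hermiteE)
    define a'' where "a'' i = (if i < n then x \<otimes> a' i else y)" for i
    define c'' where "c'' i = (if i < n then r \<otimes> c i else s)" for i
    have cl: "\<And>i. i < Suc n \<Longrightarrow> a'' i \<in> carrier R" "\<And>i. i < Suc n \<Longrightarrow> c'' i \<in> carrier R"
      using e d by (auto simp: a''_def c''_def)
    have "(\<Oplus>i\<in>{..<Suc n}. c'' i \<otimes> a'' i) = (\<Oplus>i\<in>{..<n}. c'' i \<otimes> a'' i) \<oplus> s \<otimes> y"
      using cl by (subst finsum_lessThan_Suc) (auto simp: a''_def c''_def)
    also have "(\<Oplus>i\<in>{..<n}. c'' i \<otimes> a'' i) = (\<Oplus>i\<in>{..<n}. (r \<otimes> x) \<otimes> (c i \<otimes> a' i))"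
      using e d by (intro finsum_lessThan_cong) (simp_all add: a''_def c''_def m_ac)
    also have "\<dots> = (r \<otimes> x) \<otimes> (\<Oplus>i\<in>{..<n}. c i \<otimes> a' i)"
      using e d by (subst finsum_lessThan_distrib_left) auto
    finally have "(\<Oplus>i\<in>{..<Suc n}. c'' i \<otimes> a'' i) = \<one>"
      using e d by simp
    moreover have "a i = d \<otimes> a'' i" if "i < Suc n" for i
      using that e d by (cases "i = n") (auto simp: a''_def m_assoc)
    ultimately show ?case
      using cl d(1) by blast
qed

text \<open>A common divisor is extracted from each row, then one from the vector of row divisors.
  Cofactors and coefficients multiply, and each inner sum collapses to
  \<open>k i \<otimes> e' i\<close>.\<close>

lemma hermite_matrix:
  fixes A :: "nat \<Rightarrow> nat \<Rightarrow> 'a"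
  assumes H: "hermite_ring R" and mn: "m \<ge> 1" "n \<ge> 1"
    and A: "\<forall>i<m. \<forall>j<n. A i j \<in> carrier R"
  shows "\<exists>d A' C. d \<in> carrier R \<and>
    (\<forall>i<m. \<forall>j<n. A' i j \<in> carrier R \<and> C i j \<in> carrier R \<and> A i j = d \<otimes> A' i j) \<and>
    (\<Oplus>i\<in>{..<m}. \<Oplus>j\<in>{..<n}. C i j \<otimes> A' i j) = \<one>"
proof -
  define Q where "Q i e b c \<longleftrightarrow> e \<in> carrier R \<and>
      (\<forall>j<n. b j \<in> carrier R \<and> c j \<in> carrier R \<and> A i j = e \<otimes> b j) \<and>
      (\<Oplus>j\<in>{..<n}. c j \<otimes> b j) = \<one>" for i e b c
  have "\<exists>e b c. Q i e b c" if "i < m" for i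
    unfolding Q_def using A that by (intro hermite_vector[OF H mn(2)]) simp
  then obtain e B c where Q: "\<And>i. i < m \<Longrightarrow> Q i (e i) (B i) (c i)"
    by metis
  have B: "\<forall>i<m. e i \<in> carrier R"
    "\<And>i j. i < m \<Longrightarrow> j < n \<Longrightarrow> B i j \<in> carrier R" "\<And>i j. i < m \<Longrightarrow> j < n \<Longrightarrow> c i j \<in> carrier R"
    "\<And>i j. i < m \<Longrightarrow> j < n \<Longrightarrow> A i j = e i \<otimes> B i j"
    "\<And>i. i < m \<Longrightarrow> (\<Oplus>j\<in>{..<n}. c i j \<otimes> B i j) = \<one>"
    using Q unfolding Q_def by blast+
  obtain d e' k where d: "d \<in> carrier R" "\<forall>i<m. e' i \<in> carrier R \<and> k i \<in> carrier R \<and> e i = d \<otimes> e' i"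
    "(\<Oplus>i\<in>{..<m}. k i \<otimes> e' i) = \<one>"
    using hermite_vector[where a = e, OF H mn(1) B(1)] by (elim exE conjE) (rule that)
  have "(\<Oplus>j\<in>{..<n}. (k i \<otimes> c i j) \<otimes> (e' i \<otimes> B i j)) = k i \<otimes> e' i" if i: "i < m" for i
  proof -
    have "(\<Oplus>j\<in>{..<n}. (k i \<otimes> c i j) \<otimes> (e' i \<otimes> B i j)) = (\<Oplus>j\<in>{..<n}. (k i \<otimes> e' i) \<otimes> (c i j \<otimes> B i j))"
      using i B d by (intro finsum_lessThan_cong) (simp_all add: m_ac)
    also have "\<dots> = (k i \<otimes> e' i) \<otimes> (\<Oplus>j\<in>{..<n}. c i j \<otimes> B i j)"
      using i B d by (subst finsum_lessThan_distrib_left) auto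
    finally show ?thesis
      using i B(5) d by simp
  qed
  then have "(\<Oplus>i\<in>{..<m}. \<Oplus>j\<in>{..<n}. (k i \<otimes> c i j) \<otimes> (e' i \<otimes> B i j)) = (\<Oplus>i\<in>{..<m}. k i \<otimes> e' i)"
    using d by (intro finsum_lessThan_cong) auto
  then show ?thesis
    using d B by (intro exI[of _ d] exI[of _ "\<lambda>i j. e' i \<otimes> B i j"] exI[of _ "\<lambda>i j. k i \<otimes> c i j"])
      (simp add: m_assoc)
qed

section \<open>The value 1 for unimodular matrices of every size\<close>

lemma attains_one_transpose:
  assumes "attains_one R m n"
  shows "attains_one R n m"
  unfolding attains_one_def
proof (intro allI impI)
  fix A C :: "nat \<Rightarrow> nat \<Rightarrow> 'a"
  assume R: "\<forall>i<n. \<forall>j<m. A i j \<in> carrier R \<and> C i j \<in> carrier R"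
    and one: "(\<Oplus>i\<in>{..<n}. \<Oplus>j\<in>{..<m}. C i j \<otimes> A i j) = \<one>"
  have "(\<Oplus>i\<in>{..<m}. \<Oplus>j\<in>{..<n}. C j i \<otimes> A j i) = \<one>"
    using R by (subst finsum_lessThan_swap) (simp_all add: one)
  then obtain p q where pq: "\<forall>i<m. p i \<in> carrier R" "\<forall>j<n. q j \<in> carrier R"
    "(\<Oplus>j\<in>{..<n}. (\<Oplus>i\<in>{..<m}. p i \<otimes> A j i) \<otimes> q j) = \<one>"
    using assms[unfolded attains_one_def, rule_format, of "\<lambda>i j. A j i" "\<lambda>i j. C j i"] R by auto
  have "(\<Oplus>j\<in>{..<m}. (\<Oplus>i\<in>{..<n}. q i \<otimes> A i j) \<otimes> p j)
      = (\<Oplus>i\<in>{..<n}. q i \<otimes> (\<Oplus>j\<in>{..<m}. A i j \<otimes> p j))"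
    using R pq by (intro finsum_mult_assoc) auto
  also have "\<dots> = (\<Oplus>i\<in>{..<n}. (\<Oplus>j\<in>{..<m}. p j \<otimes> A i j) \<otimes> q i)"
  proof (rule finsum_lessThan_cong)
    fix i assume i: "i < n"
    have "(\<Oplus>j\<in>{..<m}. A i j \<otimes> p j) = (\<Oplus>j\<in>{..<m}. p j \<otimes> A i j)"
      using i R pq by (intro finsum_lessThan_cong) (auto intro: m_comm)
    moreover have c: "(\<Oplus>j\<in>{..<m}. p j \<otimes> A i j) \<in> carrier R"
      using i R pq by (intro finsum_lessThan_closed) auto
    ultimately show "q i \<otimes> (\<Oplus>j\<in>{..<m}. A i j \<otimes> p j) = (\<Oplus>j\<in>{..<m}. p j \<otimes> A i j) \<otimes> q i"
      using i pq by (simp add: m_comm)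
    show "(\<Oplus>j\<in>{..<m}. p j \<otimes> A i j) \<otimes> q i \<in> carrier R"
      using c i pq by simp
  qed
  finally show "\<exists>p q. (\<forall>i<n. p i \<in> carrier R) \<and> (\<forall>j<m. q j \<in> carrier R) \<and>
      (\<Oplus>j\<in>{..<m}. (\<Oplus>i\<in>{..<n}. p i \<otimes> A i j) \<otimes> q j) = \<one>"
    using pq by (intro exI[of _ q] exI[of _ p]) simp
qed

lemma attains_one_row: "attains_one R (Suc 0) n"
  unfolding attains_one_def
proof (intro allI impI)
  fix A C :: "nat \<Rightarrow> nat \<Rightarrow> 'a"
  assume R: "\<forall>i<Suc 0. \<forall>j<n. A i j \<in> carrier R \<and> C i j \<in> carrier R"
    and one: "(\<Oplus>i\<in>{..<Suc 0}. \<Oplus>j\<in>{..<n}. C i j \<otimes> A i j) = \<one>"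
  have "(\<Oplus>j\<in>{..<n}. (\<Oplus>i\<in>{..<Suc 0}. \<one> \<otimes> A i j) \<otimes> C 0 j) = (\<Oplus>j\<in>{..<n}. C 0 j \<otimes> A 0 j)"
    using R by (intro finsum_lessThan_cong) (simp_all add: finsum_lessThan_one m_comm)
  also have "\<dots> = (\<Oplus>i\<in>{..<Suc 0}. \<Oplus>j\<in>{..<n}. C i j \<otimes> A i j)"
    using R by (subst finsum_lessThan_one) auto
  finally show "\<exists>p q. (\<forall>i<Suc 0. p i \<in> carrier R) \<and> (\<forall>j<n. q j \<in> carrier R) \<and>
      (\<Oplus>j\<in>{..<n}. (\<Oplus>i\<in>{..<Suc 0}. p i \<otimes> A i j) \<otimes> q j) = \<one>"
    using R one by (intro exI[of _ "\<lambda>_. \<one>"] exI[of _ "C 0"]) simp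
qed

text \<open>
  The first \<open>m\<close> rows are replaced by a finsum_lessThan_one combination of them that generates the same content ideal.
\<close>

lemma attains_one_Suc:
  assumes H: "hermite_ring R" and mn: "m \<ge> 1" "n \<ge> 1"
    and IH: "attains_one R m n" and two: "attains_one R 2 n"
  shows "attains_one R (Suc m) n"
  unfolding attains_one_def
proof (intro allI impI)
  fix A C :: "nat \<Rightarrow> nat \<Rightarrow> 'a"
  assume R: "\<forall>i<Suc m. \<forall>j<n. A i j \<in> carrier R \<and> C i j \<in> carrier R"
    and one: "(\<Oplus>i\<in>{..<Suc m}. \<Oplus>j\<in>{..<n}. C i j \<otimes> A i j) = \<one>"
  have A: "\<forall>i<m. \<forall>j<n. A i j \<in> carrier R"
    using R by simp
  obtain d A' C' where d: "d \<in> carrier R"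
    "\<forall>i<m. \<forall>j<n. A' i j \<in> carrier R \<and> C' i j \<in> carrier R \<and> A i j = d \<otimes> A' i j"
    "(\<Oplus>i\<in>{..<m}. \<Oplus>j\<in>{..<n}. C' i j \<otimes> A' i j) = \<one>"
    using hermite_matrix[where A = A, OF H mn A] by (elim exE conjE) (rule that)
  \<comment> \<open>The first \<open>m\<close> rows are \<open>d A'\<close>. The combination
    \<open>s\<close> of the rows of \<open>A'\<close> is unimodular, with coefficients
    \<open>q\<close>, so the single row \<open>d s\<close> still generates the ideal of
    \<open>d\<close>.\<close>
  obtain p q where pq: "\<forall>i<m. p i \<in> carrier R" "\<forall>j<n. q j \<in> carrier R"
    "(\<Oplus>j\<in>{..<n}. (\<Oplus>i\<in>{..<m}. p i \<otimes> A' i j) \<otimes> q j) = \<one>"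
    using IH[unfolded attains_one_def, rule_format, of A' C'] d by auto
  define s where "s j = (\<Oplus>i\<in>{..<m}. p i \<otimes> A' i j)" for j
  have s: "s j \<in> carrier R" if "j < n" for j
    unfolding s_def using that pq d by (intro finsum_lessThan_closed) auto
  have sq: "(\<Oplus>j\<in>{..<n}. s j \<otimes> q j) = \<one>"
    using pq(3) by (simp add: s_def)
  \<comment> \<open>The given relation reads \<open>d K\<close> plus the contribution of row
    \<open>m\<close>. The coefficients \<open>K q\<close> on the row \<open>d s\<close> reproduce
    the part \<open>d K\<close>.\<close>
  define K where "K = (\<Oplus>i\<in>{..<m}. \<Oplus>j\<in>{..<n}. C i j \<otimes> A' i j)"
  have K: "K \<in> carrier R"
    unfolding K_def using R d by (intro finsum_lessThan_closed) auto
  have dK: "(\<Oplus>i\<in>{..<m}. \<Oplus>j\<in>{..<n}. C i j \<otimes> A i j) = d \<otimes> K"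
  proof -
    have "d \<otimes> K = (\<Oplus>i\<in>{..<m}. d \<otimes> (\<Oplus>j\<in>{..<n}. C i j \<otimes> A' i j))"
      unfolding K_def using R d by (intro finsum_lessThan_distrib_left finsum_lessThan_closed) auto
    also have "\<dots> = (\<Oplus>i\<in>{..<m}. \<Oplus>j\<in>{..<n}. d \<otimes> (C i j \<otimes> A' i j))"
      using R d by (intro finsum_lessThan_cong finsum_lessThan_distrib_left finsum_lessThan_closed) auto
    also have "\<dots> = (\<Oplus>i\<in>{..<m}. \<Oplus>j\<in>{..<n}. C i j \<otimes> A i j)"
      using R d by (intro finsum_lessThan_cong finsum_lessThan_closed) (auto simp: m_lcomm)
    finally show ?thesis by simp
  qed
  \<comment> \<open>Row 0 is the last row of \<open>A\<close> and row 1 stands for all earlier ones;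
    hence \<open>P\<close> below multiplies the \<open>p i\<close> by \<open>l 1\<close> and puts
    \<open>l 0\<close> at index \<open>m\<close>.\<close>
  define B where "B i j = (if i = 0 then A m j else d \<otimes> s j)" for i j :: nat
  define D where "D i j = (if i = 0 then C m j else K \<otimes> q j)" for i j :: nat
  have BD: "B i j \<in> carrier R" "D i j \<in> carrier R" if "j < n" for i j
    using that R s K d(1) pq by (auto simp: B_def D_def)
  have "(\<Oplus>j\<in>{..<n}. (K \<otimes> q j) \<otimes> (d \<otimes> s j)) = (\<Oplus>j\<in>{..<n}. (d \<otimes> K) \<otimes> (s j \<otimes> q j))"
    using K d(1) s pq by (intro finsum_lessThan_cong) (simp_all add: m_ac)
  also have "\<dots> = (d \<otimes> K) \<otimes> (\<Oplus>j\<in>{..<n}. s j \<otimes> q j)"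
    using K d(1) s pq by (subst finsum_lessThan_distrib_left) auto
  finally have Kq: "(\<Oplus>j\<in>{..<n}. (K \<otimes> q j) \<otimes> (d \<otimes> s j)) = d \<otimes> K"
    using sq K d(1) by simp
  have cl: "(\<Oplus>j\<in>{..<n}. C m j \<otimes> A m j) \<in> carrier R"
    using R by (intro finsum_lessThan_closed) auto
  have "(\<Oplus>i\<in>{..<2}. \<Oplus>j\<in>{..<n}. D i j \<otimes> B i j) = (\<Oplus>j\<in>{..<n}. C m j \<otimes> A m j) \<oplus> d \<otimes> K"
    using BD cl K d(1) by (subst finsum_lessThan_two) (simp_all add: B_def D_def Kq)
  also have "\<dots> = (\<Oplus>i\<in>{..<Suc m}. \<Oplus>j\<in>{..<n}. C i j \<otimes> A i j)"
    using R cl K d(1) by (subst finsum_lessThan_Suc) (auto simp: dK a_comm)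
  finally have "(\<Oplus>i\<in>{..<2}. \<Oplus>j\<in>{..<n}. D i j \<otimes> B i j) = \<one>"
    using one by simp
  then obtain l y where ly: "\<forall>i<2. l i \<in> carrier R" "\<forall>j<n. y j \<in> carrier R"
    "(\<Oplus>j\<in>{..<n}. (\<Oplus>i\<in>{..<2}. l i \<otimes> B i j) \<otimes> y j) = \<one>"
    using two[unfolded attains_one_def, rule_format, of B D] BD by auto
  define P where "P i = (if i < m then l 1 \<otimes> p i else l 0)" for i
  have P: "P i \<in> carrier R" if "i < Suc m" for i
    using that ly pq by (simp add: P_def)
  have "(\<Oplus>i\<in>{..<Suc m}. P i \<otimes> A i j) = (\<Oplus>i\<in>{..<2}. l i \<otimes> B i j)" if j: "j < n" for j
  proof -
    have "(\<Oplus>i\<in>{..<m}. P i \<otimes> A i j) = (\<Oplus>i\<in>{..<m}. (l 1 \<otimes> d) \<otimes> (p i \<otimes> A' i j))"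
      using j ly pq d by (intro finsum_lessThan_cong) (simp_all add: P_def m_ac)
    also have "\<dots> = l 1 \<otimes> (d \<otimes> s j)"
      unfolding s_def using j ly pq d
      by (subst finsum_lessThan_distrib_left[symmetric]) (auto simp: m_assoc intro!: finsum_lessThan_closed)
    finally have "(\<Oplus>i\<in>{..<Suc m}. P i \<otimes> A i j) = l 1 \<otimes> (d \<otimes> s j) \<oplus> l 0 \<otimes> A m j"
      using j R P by (subst finsum_lessThan_Suc) (auto simp: P_def)
    also have "\<dots> = l 0 \<otimes> A m j \<oplus> l 1 \<otimes> (d \<otimes> s j)"
      using j R ly d(1) s by (intro a_comm) auto
    also have "\<dots> = (\<Oplus>i\<in>{..<2}. l i \<otimes> B i j)"
      using j R ly d(1) s by (subst finsum_lessThan_two) (auto simp: B_def)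
    finally show ?thesis .
  qed
  then have "(\<Oplus>j\<in>{..<n}. (\<Oplus>i\<in>{..<Suc m}. P i \<otimes> A i j) \<otimes> y j) = \<one>"
    using BD ly by (subst ly(3)[symmetric], intro finsum_lessThan_cong) (auto intro!: m_closed finsum_lessThan_closed)
  then show "\<exists>p q. (\<forall>i<Suc m. p i \<in> carrier R) \<and> (\<forall>j<n. q j \<in> carrier R) \<and>
      (\<Oplus>j\<in>{..<n}. (\<Oplus>i\<in>{..<Suc m}. p i \<otimes> A i j) \<otimes> q j) = \<one>"
    using P ly(2) by blast
qed

text \<open>Adding a row uses the two-row case of the same width. For width 2 that is the
  hypothesis, so every height is reached. Transposition yields two rows of any width, and a second
  induction every size.\<close>

lemma attains_one_all:
  assumes H: "hermite_ring R" and "attains_one R 2 2" and "m \<ge> 1" "n \<ge> 1"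
  shows "attains_one R m n"
proof -
  have "attains_one R k 2" if "k \<ge> 1" for k
    using that by (induction k rule: dec_induct) (simp_all add: attains_one_row attains_one_Suc assms(1,2))
  then have "attains_one R 2 n"
    using assms(4) attains_one_transpose by blast
  with assms(3) show ?thesis
    by (induction m rule: dec_induct) (use assms(4) in \<open>simp_all add: attains_one_row attains_one_Suc assms(1)\<close>)
qed

end

section \<open>Completion to invertible matrices\<close>

text \<open>The diagonal takes precedence at \<open>(0, 0)\<close>: the entry there is 1 and not
  \<open>f 0\<close>, so a column \<open>z\<close> with \<open>z 0 = 1\<close> can be cleared by
  taking \<open>f\<close> to be the negative of \<open>z\<close>.\<close>

definition transvection_mat :: "('a, 'm) ring_scheme \<Rightarrow> nat \<Rightarrow> (nat \<Rightarrow> 'a) \<Rightarrow> 'a mat" where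
  "transvection_mat R n f = mat n n (\<lambda>(i, j).
     if i = j then \<one>\<^bsub>R\<^esub> else if j = 0 then f i else \<zero>\<^bsub>R\<^esub>)"

definition rmat_scale :: "('a, 'm) ring_scheme \<Rightarrow> 'a \<Rightarrow> 'a mat \<Rightarrow> 'a mat" where
  "rmat_scale R d A = map_mat (\<lambda>x. d \<otimes>\<^bsub>R\<^esub> x) A"

context cring
begin

lemma transvection_closed:
  assumes "\<And>i. i < n \<Longrightarrow> f i \<in> carrier R"
  shows "transvection_mat R n f \<in> ring_mats R n n"
  using assms by (simp add: transvection_mat_def ring_mats_iff)

lemma index_transvection_mult:
  assumes f: "\<And>i. i < n \<Longrightarrow> f i \<in> carrier R" and A: "A \<in> ring_mats R n k" and ij: "i < n" "j < k"
  shows "rmat_mult R (transvection_mat R n f) A $$ (i, j)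
    = A $$ (i, j) \<oplus> (if i = 0 then \<zero> else f i \<otimes> A $$ (0, j))"
proof -
  have Ac: "A $$ (l, j) \<in> carrier R" if "l < n" for l
    using A ij that by (simp add: ring_mats_iff)
  have "rmat_mult R (transvection_mat R n f) A $$ (i, j)
      = (\<Oplus>l\<in>{..<n}. transvection_mat R n f $$ (i, l) \<otimes> A $$ (l, j))"
    by (rule index_rmat_mult[OF transvection_closed[OF f] A ij])
  also have "\<dots> = (\<Oplus>l\<in>{..<n}. (if l = i then A $$ (i, j) else \<zero>)
      \<oplus> (if l = 0 \<and> i \<noteq> 0 then f i \<otimes> A $$ (0, j) else \<zero>))"
    using ij f Ac by (intro finsum_lessThan_cong) (auto simp: transvection_mat_def)
  also have "\<dots> = (\<Oplus>l\<in>{..<n}. if l = i then A $$ (i, j) else \<zero>)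
      \<oplus> (\<Oplus>l\<in>{..<n}. if l = 0 \<and> i \<noteq> 0 then f i \<otimes> A $$ (0, j) else \<zero>)"
    using ij f Ac by (intro finsum_addf) (auto simp: Pi_def)
  also have "(\<Oplus>l\<in>{..<n}. if l = i then A $$ (i, j) else \<zero>) = A $$ (i, j)"
    using ij Ac by (subst finsum_lessThan_single[of i]) auto
  also have "(\<Oplus>l\<in>{..<n}. if l = 0 \<and> i \<noteq> 0 then f i \<otimes> A $$ (0, j) else \<zero>)
      = (if i = 0 then \<zero> else f i \<otimes> A $$ (0, j))"
    using ij f Ac by (subst finsum_lessThan_single[of 0]) auto
  finally show ?thesis .
qed

text \<open>Symmetric in \<open>f\<close> and \<open>g\<close>, so that both inverse identities of a
  transvection are instances.\<close>

lemma transvection_mult: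
  assumes f: "\<And>i. i < n \<Longrightarrow> f i \<in> carrier R" and g: "\<And>i. i < n \<Longrightarrow> g i \<in> carrier R"
    and fg: "\<And>i. i < n \<Longrightarrow> f i \<oplus> g i = \<zero>"
  shows "rmat_mult R (transvection_mat R n f) (transvection_mat R n g) = rmat_one R n"
proof (rule ring_mats_eqI)
  show "rmat_mult R (transvection_mat R n f) (transvection_mat R n g) \<in> ring_mats R n n"
    using f g by (intro rmat_mult_closed[of _ n n] transvection_closed)
  show "rmat_one R n \<in> ring_mats R n n"
    by (rule rmat_one_closed)
  fix i j assume ij: "i < n" "j < n"
  have "g i \<oplus> f i = \<zero>"
    using fg[OF ij(1)] f[OF ij(1)] g[OF ij(1)] by (simp add: a_comm)
  then show "rmat_mult R (transvection_mat R n f) (transvection_mat R n g) $$ (i, j) = rmat_one R n $$ (i, j)"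
    using ij f g by (subst index_transvection_mult[OF f transvection_closed[OF g] ij])
      (auto simp: transvection_mat_def rmat_one_def)
qed

lemma GL_transvection:
  assumes f: "\<And>i. i < n \<Longrightarrow> f i \<in> carrier R"
  shows "transvection_mat R n f \<in> GL R n"
  using f by (intro GL_I[of _ _ "transvection_mat R n (\<lambda>i. \<ominus> f i)"] transvection_closed transvection_mult)
    (auto simp: r_neg l_neg)

text \<open>The tail of \<open>p\<close> is \<open>e a\<close> with \<open>a\<close> unimodular. By
  induction \<open>a\<close> is the first row of an invertible matrix, and a two by two step joins
  \<open>p 0\<close> with \<open>e\<close>.\<close>

lemma unimodular_row_completion:
  fixes p c :: "nat \<Rightarrow> 'a"
  assumes H: "hermite_ring R" and "n \<ge> 1"
    and "\<forall>i<n. p i \<in> carrier R" "\<forall>i<n. c i \<in> carrier R" "(\<Oplus>i\<in>{..<n}. c i \<otimes> p i) = \<one>"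
  shows "\<exists>P \<in> GL R n. \<forall>j<n. P $$ (0, j) = p j"
  using assms(2-)
proof (induction n arbitrary: p c rule: dec_induct)
  case base
  have cp: "c 0 \<otimes> p 0 = \<one>"
    using base finsum_lessThan_single[of 0 1 "\<lambda>i. c i \<otimes> p i"] by simp
  have cl: "mat 1 1 (\<lambda>_. p 0) \<in> ring_mats R 1 1" "mat 1 1 (\<lambda>_. c 0) \<in> ring_mats R 1 1"
    using base by (auto intro: mat_in_ring_mats)
  have mult: "rmat_mult R (mat 1 1 (\<lambda>_. x)) (mat 1 1 (\<lambda>_. y)) = rmat_one R 1"
    if "x \<in> carrier R" "y \<in> carrier R" "x \<otimes> y = \<one>" for x y
    using that by (intro eq_matI) (auto simp: rmat_mult_def rmat_one_def finsum_lessThan_one)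
  have "mat 1 1 (\<lambda>_. p 0) \<in> GL R 1"
    using base cp by (intro GL_I[OF cl] mult) (simp_all add: m_comm)
  then show ?case
    by (intro bexI[of _ "mat 1 1 (\<lambda>_. p 0)"]) simp_all
next
  case (step n)
  then obtain k where k: "n = Suc k"
    by (cases n) auto
  have cl: "p i \<in> carrier R" "c i \<in> carrier R" if "i < Suc n" for i
    using that step.prems by auto
  have tail: "\<forall>i<n. p (Suc i) \<in> carrier R"
    using cl by simp
  obtain e a b where e: "e \<in> carrier R"
    "\<forall>i<n. a i \<in> carrier R \<and> b i \<in> carrier R \<and> p (Suc i) = e \<otimes> a i"
    "(\<Oplus>i\<in>{..<n}. b i \<otimes> a i) = \<one>"
    using hermite_vector[OF H step.hyps(1) tail] by (elim exE conjE) (rule that)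
  obtain S where S: "S \<in> GL R n" "\<forall>j<n. S $$ (0, j) = a j"
    using step.IH[of a b] e by auto
  define K where "K = (\<Oplus>i\<in>{..<n}. c (Suc i) \<otimes> a i)"
  have K: "K \<in> carrier R"
    unfolding K_def using cl e by (intro finsum_lessThan_closed) auto
  have "(\<Oplus>i\<in>{..<n}. c (Suc i) \<otimes> p (Suc i)) = (\<Oplus>i\<in>{..<n}. e \<otimes> (c (Suc i) \<otimes> a i))"
    using cl e by (intro finsum_lessThan_cong) (auto simp: m_lcomm)
  also have "\<dots> = e \<otimes> K"
    unfolding K_def using cl e by (intro finsum_lessThan_distrib_left[symmetric]) auto
  finally have eK: "(\<Oplus>i\<in>{..<n}. c (Suc i) \<otimes> p (Suc i)) = e \<otimes> K" .
  have "(\<Oplus>i\<in>{..<1 + n}. c i \<otimes> p i) = (\<Oplus>i\<in>{..<1}. c i \<otimes> p i) \<oplus> (\<Oplus>i\<in>{..<n}. c (1 + i) \<otimes> p (1 + i))"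
    using cl by (intro finsum_lessThan_add) auto
  also have "(\<Oplus>i\<in>{..<1}. c i \<otimes> p i) = c 0 \<otimes> p 0"
    using cl by (intro finsum_lessThan_single) auto
  finally have det: "c 0 \<otimes> p 0 \<oplus> e \<otimes> K = \<one>"
    using step.prems(3) eK by simp
  have "p 0 \<otimes> c 0 \<ominus> e \<otimes> \<ominus> K = c 0 \<otimes> p 0 \<oplus> e \<otimes> K"
    using cl(1)[OF zero_less_Suc] cl(2)[OF zero_less_Suc] e(1) K by algebra
  then have M: "mat2 (p 0) e (\<ominus> K) (c 0) \<in> GL R 2"
    using cl[of 0] e(1) K det by (intro mat2_GL) auto
  \<comment> \<open>The rows 0 and 1 of \<open>V\<close> are \<open>(1, 0)\<close> and
    \<open>(0, a)\<close>, and row 0 of \<open>T\<close> is \<open>(p 0, e, 0, ..., 0)\<close>, so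
    row 0 of \<open>T V\<close> is \<open>(p 0, e a)\<close>. \<open>K\<close> makes the corner of
    \<open>T\<close> have determinant 1. Both sizes are \<open>Suc n\<close>, as
    \<open>n = Suc k\<close>.\<close>
  define T where "T = dsum R (mat2 (p 0) e (\<ominus> K) (c 0)) (rmat_one R k)"
  define V where "V = dsum R (rmat_one R 1) S"
  have T: "T \<in> GL R (Suc n)" and V: "V \<in> GL R (Suc n)"
    using GL_dsum[OF M GL_one[of k]] GL_dsum[OF GL_one[of 1] S(1)] k by (simp_all add: T_def V_def)
  note TV = GL_closed[OF T] GL_closed[OF V]
  have T0: "T $$ (0, l) = (if l = 0 then p 0 else if l = 1 then e else \<zero>)" if "l < Suc n" for l
    using that k index_dsum[OF GL_closed[OF M] rmat_one_closed[of k], of 0 l] less_two_cases[of l]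
    by (auto simp: T_def)
  have V0: "V $$ (0, j) = (if j = 0 then \<one> else \<zero>)"
    "V $$ (Suc 0, j) = (if j = 0 then \<zero> else a (j - 1))" if "j < Suc n" for j
    using that k S(2) index_dsum[OF rmat_one_closed[of 1] GL_closed[OF S(1)], of 0 j]
      index_dsum[OF rmat_one_closed[of 1] GL_closed[OF S(1)], of "Suc 0" j]
    by (auto simp: V_def rmat_one_def)
  have "rmat_mult R T V $$ (0, j) = p j" if j: "j < Suc n" for j
  proof -
    have Vc: "V $$ (l, j) \<in> carrier R" if "l < Suc n" for l
      using TV(2) that j by (simp add: ring_mats_iff)
    have "rmat_mult R T V $$ (0, j) = (\<Oplus>l\<in>{..<2 + k}. T $$ (0, l) \<otimes> V $$ (l, j))"
      using j k by (subst index_rmat_mult[OF TV]) auto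
    also have "\<dots> = (\<Oplus>l\<in>{..<2}. T $$ (0, l) \<otimes> V $$ (l, j))
        \<oplus> (\<Oplus>l\<in>{..<k}. T $$ (0, 2 + l) \<otimes> V $$ (2 + l, j))"
      using k T0 Vc cl e(1) by (intro finsum_lessThan_add) auto
    also have "(\<Oplus>l\<in>{..<k}. T $$ (0, 2 + l) \<otimes> V $$ (2 + l, j)) = \<zero>"
      using k T0 Vc by (intro finsum_lessThan_zero) auto
    also have "(\<Oplus>l\<in>{..<2}. T $$ (0, l) \<otimes> V $$ (l, j)) = p 0 \<otimes> V $$ (0, j) \<oplus> e \<otimes> V $$ (Suc 0, j)"
      using k T0 Vc cl e(1) by (subst finsum_lessThan_two) auto
    finally show ?thesis
      using V0[OF j] cl[of 0] e j by (cases j) auto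
  qed
  then show ?case
    using GL_mult[OF T V] by blast
qed

text \<open>Complete \<open>p\<close> to an invertible \<open>P\<close>. The column
  \<open>P w\<close> then starts with 1, and a transvection clears the rest of it without touching
  row 0.\<close>

lemma dual_pair_completion:
  assumes H: "hermite_ring R" and n: "n \<ge> 1"
    and p: "p \<in> ring_mats R 1 n" and w: "w \<in> ring_mats R n 1"
    and pw: "rmat_mult R p w = rmat_one R 1"
  shows "\<exists>P \<in> GL R n. (\<forall>j<n. P $$ (0, j) = p $$ (0, j)) \<and>
    (\<forall>i<n. rmat_mult R P w $$ (i, 0) = (if i = 0 then \<one> else \<zero>))"
proof -
  have cl: "p $$ (0, i) \<in> carrier R" "w $$ (i, 0) \<in> carrier R" if "i < n" for i
    using p w that by (auto simp: ring_mats_iff)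
  have sum: "(\<Oplus>i\<in>{..<n}. p $$ (0, i) \<otimes> w $$ (i, 0)) = \<one>"
    using pw index_rmat_mult[OF p w, of 0 0] by (simp add: rmat_one_def)
  also have "(\<Oplus>i\<in>{..<n}. p $$ (0, i) \<otimes> w $$ (i, 0)) = (\<Oplus>i\<in>{..<n}. w $$ (i, 0) \<otimes> p $$ (0, i))"
    using cl by (intro finsum_lessThan_cong m_comm) auto
  finally obtain P where P: "P \<in> GL R n" "\<forall>j<n. P $$ (0, j) = p $$ (0, j)"
    using unimodular_row_completion[OF H n, of "\<lambda>i. p $$ (0, i)" "\<lambda>i. w $$ (i, 0)"] cl by auto
  note Pc = GL_closed[OF P(1)]
  define z where "z i = rmat_mult R P w $$ (i, 0)" for i
  have z: "z i \<in> carrier R" if "i < n" for i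
    using rmat_mult_closed[OF Pc w] that by (simp add: z_def ring_mats_iff)
  have z0: "z 0 = \<one>"
    using n P cl sum by (simp add: z_def index_rmat_mult[OF Pc w] cong: finsum_lessThan_cong)
  have nz: "\<And>i. i < n \<Longrightarrow> \<ominus> z i \<in> carrier R"
    using z by simp
  define E where "E = transvection_mat R n (\<lambda>i. \<ominus> z i)"
  have E: "E \<in> GL R n"
    unfolding E_def by (rule GL_transvection[OF nz])
  have "rmat_mult R E P $$ (0, j) = p $$ (0, j)" if "j < n" for j
    using n P(2) cl that by (simp add: E_def index_transvection_mult[OF nz Pc])
  moreover have "rmat_mult R (rmat_mult R E P) w $$ (i, 0) = (if i = 0 then \<one> else \<zero>)" if i: "i < n" for i
  proof -
    have "rmat_mult R (rmat_mult R E P) w $$ (i, 0) = rmat_mult R E (rmat_mult R P w) $$ (i, 0)"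
      using rmat_mult_assoc[OF GL_closed[OF E] Pc w] by simp
    also have "\<dots> = z i \<oplus> (if i = 0 then \<zero> else \<ominus> z i \<otimes> z 0)"
      unfolding E_def using i by (subst index_transvection_mult[OF nz rmat_mult_closed[OF Pc w]]) (simp_all add: z_def)
    finally show ?thesis
      using z0 z[OF i] by (simp add: r_neg)
  qed
  ultimately show ?thesis
    using GL_mult[OF E P(1)] by blast
qed

text \<open>The two left factors may differ in height; this allows row 0 of a square matrix to be
  compared with a one-row matrix.\<close>

lemma rmat_mult_row_cong:
  assumes "A \<in> ring_mats R m k" "A' \<in> ring_mats R m' k" "B \<in> ring_mats R k n" "i < m" "i' < m'" "j < n"
    "\<And>l. l < k \<Longrightarrow> A $$ (i, l) = A' $$ (i', l)"
  shows "rmat_mult R A B $$ (i, j) = rmat_mult R A' B $$ (i', j)"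
  using assms by (simp add: index_rmat_mult[OF assms(1,3)] index_rmat_mult[OF assms(2,3)])
    (intro finsum_lessThan_cong, auto simp: ring_mats_iff)

lemma rmat_mult_col_cong:
  assumes "A \<in> ring_mats R m k" "B \<in> ring_mats R k n" "B' \<in> ring_mats R k n'" "i < m" "j < n" "j' < n'"
    "\<And>l. l < k \<Longrightarrow> B $$ (l, j) = B' $$ (l, j')"
  shows "rmat_mult R A B $$ (i, j) = rmat_mult R A B' $$ (i, j')"
  using assms by (simp add: index_rmat_mult[OF assms(1,2)] index_rmat_mult[OF assms(1,3)])
    (intro finsum_lessThan_cong, auto simp: ring_mats_iff)

text \<open>\<open>P\<close> has first row \<open>p\<close> and sends \<open>A q\<close> to the
  first unit column; \<open>Q\<close> has first column \<open>q\<close> and sends \<open>p A\<close>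
  to the first unit row. So \<open>P A Q\<close> has first column \<open>P A q\<close> and first row
  \<open>p A Q\<close>, which are those of a split 1.\<close>

lemma split_off_one:
  assumes H: "hermite_ring R"
    and A: "A \<in> ring_mats R (Suc m) (Suc n)"
    and p: "p \<in> ring_mats R 1 (Suc m)" and q: "q \<in> ring_mats R (Suc n) 1"
    and one: "rmat_mult R (rmat_mult R p A) q = rmat_one R 1"
  shows "\<exists>P \<in> GL R (Suc m). \<exists>Q \<in> GL R (Suc n). \<exists>C \<in> ring_mats R m n.
    rmat_mult R (rmat_mult R P A) Q = dsum R (rmat_one R 1) C"
proof -
  note pA = rmat_mult_closed[OF p A] and Aq = rmat_mult_closed[OF A q]
  have "rmat_mult R p (rmat_mult R A q) = rmat_one R 1"
    using one rmat_mult_assoc[OF p A q] by simp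
  then obtain P where P: "P \<in> GL R (Suc m)" "\<forall>j<Suc m. P $$ (0, j) = p $$ (0, j)"
    "\<forall>i<Suc m. rmat_mult R P (rmat_mult R A q) $$ (i, 0) = (if i = 0 then \<one> else \<zero>)"
    using dual_pair_completion[OF H _ p Aq] by auto
  \<comment> \<open>\<open>Q\<close> is obtained by completing the transposed pair of
    \<open>q\<close> and \<open>p A\<close>.\<close>
  have "rmat_mult R (transpose_mat q) (transpose_mat (rmat_mult R p A)) = rmat_one R 1"
    using one transpose_rmat_mult[OF pA q] transpose_rmat_one by metis
  then obtain Q' where Q': "Q' \<in> GL R (Suc n)" "\<forall>j<Suc n. Q' $$ (0, j) = transpose_mat q $$ (0, j)"
    "\<forall>i<Suc n. rmat_mult R Q' (transpose_mat (rmat_mult R p A)) $$ (i, 0) = (if i = 0 then \<one> else \<zero>)"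
    using dual_pair_completion[OF H _ transpose_closed[OF q] transpose_closed[OF pA]] by auto
  define Q where "Q = transpose_mat Q'"
  have Q: "Q \<in> GL R (Suc n)"
    unfolding Q_def by (rule GL_transpose[OF Q'(1)])
  note Pc = GL_closed[OF P(1)] and Qc = GL_closed[OF Q] and Qc' = GL_closed[OF Q'(1)]
  note PA = rmat_mult_closed[OF Pc A] and AQ = rmat_mult_closed[OF A Qc]
  define B where "B = rmat_mult R (rmat_mult R P A) Q"
  have B: "B \<in> ring_mats R (Suc m) (Suc n)"
    unfolding B_def by (rule rmat_mult_closed[OF PA Qc])
  have Qq: "Q $$ (l, 0) = q $$ (l, 0)" if "l < Suc n" for l
    using that Q'(2) Qc' q by (simp add: Q_def ring_mats_iff)
  have col: "B $$ (i, 0) = (if i = 0 then \<one> else \<zero>)" if i: "i < Suc m" for i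
  proof -
    have "B $$ (i, 0) = rmat_mult R (rmat_mult R P A) q $$ (i, 0)"
      unfolding B_def using i Qq by (intro rmat_mult_col_cong[OF PA Qc q]) auto
    then show ?thesis
      using rmat_mult_assoc[OF Pc A q] P(3) i by simp
  qed
  have row: "B $$ (0, j) = (if j = 0 then \<one> else \<zero>)" if j: "j < Suc n" for j
  proof -
    have "B $$ (0, j) = rmat_mult R P (rmat_mult R A Q) $$ (0, j)"
      unfolding B_def using rmat_mult_assoc[OF Pc A Qc] by simp
    also have "\<dots> = rmat_mult R p (rmat_mult R A Q) $$ (0, j)"
      using j P(2) by (intro rmat_mult_row_cong[OF Pc p AQ]) auto
    also have "\<dots> = rmat_mult R (rmat_mult R p A) Q $$ (0, j)"
      using rmat_mult_assoc[OF p A Qc] by simp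
    also have "\<dots> = transpose_mat (rmat_mult R (rmat_mult R p A) Q) $$ (j, 0)"
      using j rmat_mult_closed[OF pA Qc] by (simp add: ring_mats_iff)
    also have "transpose_mat (rmat_mult R (rmat_mult R p A) Q) = rmat_mult R Q' (transpose_mat (rmat_mult R p A))"
      using transpose_rmat_mult[OF pA Qc] by (simp add: Q_def)
    finally show ?thesis
      using Q'(3) j by simp
  qed
  define C where "C = mat m n (\<lambda>(i, j). B $$ (Suc i, Suc j))"
  have C: "C \<in> ring_mats R m n"
    using B by (simp add: C_def ring_mats_iff)
  have dC: "dsum R (rmat_one R 1) C \<in> ring_mats R (Suc m) (Suc n)"
    using dsum_closed[OF rmat_one_closed[of 1] C] by simp
  have "B = dsum R (rmat_one R 1) C"
  proof (rule ring_mats_eqI[OF B dC])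
    fix i j assume ij: "i < Suc m" "j < Suc n"
    then show "B $$ (i, j) = dsum R (rmat_one R 1) C $$ (i, j)"
      using index_dsum[OF rmat_one_closed[of 1] C, of i j] row[of j] col[of i]
      by (cases i; cases j) (auto simp: C_def rmat_one_def)
  qed
  then show ?thesis
    using P(1) Q C unfolding B_def by blast
qed

section \<open>Scalar multiples of matrices\<close>

lemma rmat_scale_closed:
  "A \<in> ring_mats R m n \<Longrightarrow> d \<in> carrier R \<Longrightarrow> rmat_scale R d A \<in> ring_mats R m n"
  by (simp add: rmat_scale_def ring_mats_iff)

lemma rmat_mult_scale_left:
  assumes A: "A \<in> ring_mats R m k" and B: "B \<in> ring_mats R k n" and d: "d \<in> carrier R"
  shows "rmat_mult R (rmat_scale R d A) B = rmat_scale R d (rmat_mult R A B)"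
proof (rule ring_mats_eqI)
  note AB = rmat_mult_closed[OF A B]
  show "rmat_mult R (rmat_scale R d A) B \<in> ring_mats R m n"
    "rmat_scale R d (rmat_mult R A B) \<in> ring_mats R m n"
    using A B d by (auto intro!: rmat_mult_closed rmat_scale_closed)
  fix i j assume ij: "i < m" "j < n"
  have "rmat_scale R d (rmat_mult R A B) $$ (i, j) = d \<otimes> rmat_mult R A B $$ (i, j)"
    using ij AB by (simp add: rmat_scale_def ring_mats_iff)
  also have "\<dots> = (\<Oplus>l\<in>{..<k}. d \<otimes> (A $$ (i, l) \<otimes> B $$ (l, j)))"
    unfolding index_rmat_mult[OF A B ij] using A B d ij
    by (intro finsum_lessThan_distrib_left) (auto simp: ring_mats_iff)
  also have "\<dots> = rmat_mult R (rmat_scale R d A) B $$ (i, j)"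
    unfolding index_rmat_mult[OF rmat_scale_closed[OF A d] B ij] using A B d ij
    by (intro finsum_lessThan_cong) (auto simp: ring_mats_iff rmat_scale_def m_assoc)
  finally show "rmat_mult R (rmat_scale R d A) B $$ (i, j) = rmat_scale R d (rmat_mult R A B) $$ (i, j)"
    by simp
qed

lemma rmat_mult_scale_right:
  assumes A: "A \<in> ring_mats R m k" and B: "B \<in> ring_mats R k n" and d: "d \<in> carrier R"
  shows "rmat_mult R A (rmat_scale R d B) = rmat_scale R d (rmat_mult R A B)"
proof (rule ring_mats_eqI)
  note AB = rmat_mult_closed[OF A B]
  show "rmat_mult R A (rmat_scale R d B) \<in> ring_mats R m n"
    "rmat_scale R d (rmat_mult R A B) \<in> ring_mats R m n"
    using A B d by (auto intro!: rmat_mult_closed rmat_scale_closed)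
  fix i j assume ij: "i < m" "j < n"
  have "rmat_scale R d (rmat_mult R A B) $$ (i, j) = d \<otimes> rmat_mult R A B $$ (i, j)"
    using ij AB by (simp add: rmat_scale_def ring_mats_iff)
  also have "\<dots> = (\<Oplus>l\<in>{..<k}. d \<otimes> (A $$ (i, l) \<otimes> B $$ (l, j)))"
    unfolding index_rmat_mult[OF A B ij] using A B d ij
    by (intro finsum_lessThan_distrib_left) (auto simp: ring_mats_iff)
  also have "\<dots> = rmat_mult R A (rmat_scale R d B) $$ (i, j)"
    unfolding index_rmat_mult[OF A rmat_scale_closed[OF B d] ij] using A B d ij
    by (intro finsum_lessThan_cong) (auto simp: ring_mats_iff rmat_scale_def m_lcomm)
  finally show "rmat_mult R A (rmat_scale R d B) $$ (i, j) = rmat_scale R d (rmat_mult R A B) $$ (i, j)"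
    by simp
qed

end

section \<open>Diagonal reduction\<close>

definition divisibility_diagonal :: "('a, 'm) ring_scheme \<Rightarrow> nat \<Rightarrow> nat \<Rightarrow> 'a mat \<Rightarrow> bool" where
  "divisibility_diagonal R m n D \<longleftrightarrow>
     (\<forall>i<m. \<forall>j<n. i \<noteq> j \<longrightarrow> D $$ (i, j) = \<zero>\<^bsub>R\<^esub>) \<and>
     (\<forall>i. Suc i < min m n \<longrightarrow> D $$ (i, i) divides\<^bsub>R\<^esub> D $$ (Suc i, Suc i))"

context cring
begin

text \<open>The scalar multiplies the whole block sum: the new corner \<open>d\<close> divides
  \<open>d\<close> times the first entry of \<open>D\<close>, and the divisibilities within
  \<open>D\<close> survive scaling.\<close>

lemma divisibility_diagonal_Suc:
  assumes D: "D \<in> ring_mats R m n" "divisibility_diagonal R m n D" and d: "d \<in> carrier R"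
  shows "divisibility_diagonal R (Suc m) (Suc n) (rmat_scale R d (dsum R (rmat_one R 1) D))"
proof -
  define S where "S = rmat_scale R d (dsum R (rmat_one R 1) D)"
  have S: "S $$ (i, j) = d \<otimes> (if i = 0 then (if j = 0 then \<one> else \<zero>)
      else (if j = 0 then \<zero> else D $$ (i - 1, j - 1)))" if "i < Suc m" "j < Suc n" for i j
    using that index_dsum[OF rmat_one_closed[of 1] D(1), of i j] dsum_closed[OF rmat_one_closed[of 1] D(1)]
    by (simp add: S_def rmat_scale_def ring_mats_iff rmat_one_def)
  have "S $$ (i, j) = \<zero>" if "i < Suc m" "j < Suc n" "i \<noteq> j" for i j
    using that D(2) d S[OF that(1,2)] unfolding divisibility_diagonal_def
    by (cases i; cases j) auto
  moreover have "S $$ (i, i) divides S $$ (Suc i, Suc i)" if i: "Suc i < min (Suc m) (Suc n)" for i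
  proof (cases i)
    case 0
    then have "D $$ (0, 0) \<in> carrier R"
      using i D(1) by (simp add: ring_mats_iff)
    then show ?thesis
      using i 0 d by (auto simp: S factor_def)
  next
    case (Suc k)
    then have "D $$ (k, k) divides D $$ (Suc k, Suc k)"
      using i D(2) unfolding divisibility_diagonal_def by simp
    then obtain c where "c \<in> carrier R" "D $$ (Suc k, Suc k) = D $$ (k, k) \<otimes> c"
      by (auto simp: factor_def)
    moreover have "D $$ (k, k) \<in> carrier R"
      using i Suc D(1) by (simp add: ring_mats_iff)
    ultimately have "d \<otimes> D $$ (Suc k, Suc k) = (d \<otimes> D $$ (k, k)) \<otimes> c" "c \<in> carrier R"
      using d by (simp_all add: m_assoc)
    then show ?thesis
      using i Suc by (auto simp: S factor_def)
  qed
  ultimately show ?thesis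
    unfolding divisibility_diagonal_def S_def by blast
qed

lemma attains_one_mats:
  assumes "attains_one R m n" and A: "A \<in> ring_mats R m n"
    and C: "\<forall>i<m. \<forall>j<n. C i j \<in> carrier R" "(\<Oplus>i\<in>{..<m}. \<Oplus>j\<in>{..<n}. C i j \<otimes> A $$ (i, j)) = \<one>"
  shows "\<exists>p \<in> ring_mats R 1 m. \<exists>q \<in> ring_mats R n 1. rmat_mult R (rmat_mult R p A) q = rmat_one R 1"
proof -
  have "\<forall>i<m. \<forall>j<n. A $$ (i, j) \<in> carrier R"
    using A by (simp add: ring_mats_iff)
  then obtain p q where pq: "\<forall>i<m. p i \<in> carrier R" "\<forall>j<n. q j \<in> carrier R"
    "(\<Oplus>j\<in>{..<n}. (\<Oplus>i\<in>{..<m}. p i \<otimes> A $$ (i, j)) \<otimes> q j) = \<one>"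
    using assms(1)[unfolded attains_one_def, rule_format, of "\<lambda>i j. A $$ (i, j)" C] C by auto
  define p' where "p' = mat 1 m (\<lambda>(i, j). p j)"
  define q' where "q' = mat n 1 (\<lambda>(i, j). q i)"
  have p': "p' \<in> ring_mats R 1 m" and q': "q' \<in> ring_mats R n 1"
    using pq by (simp_all add: p'_def q'_def ring_mats_iff)
  note pA = rmat_mult_closed[OF p' A]
  have row: "rmat_mult R p' A $$ (0, j) = (\<Oplus>i\<in>{..<m}. p i \<otimes> A $$ (i, j))" if j: "j < n" for j
    using pq(1) A j by (subst index_rmat_mult[OF p' A]) (auto simp: p'_def ring_mats_iff intro!: finsum_lessThan_cong)
  have "rmat_mult R (rmat_mult R p' A) q' $$ (0, 0) = (\<Oplus>j\<in>{..<n}. rmat_mult R p' A $$ (0, j) \<otimes> q' $$ (j, 0))"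
    by (rule index_rmat_mult[OF pA q']) simp_all
  also have "\<dots> = (\<Oplus>j\<in>{..<n}. (\<Oplus>i\<in>{..<m}. p i \<otimes> A $$ (i, j)) \<otimes> q j)"
    using pq(2) pA by (intro finsum_lessThan_cong) (auto simp: ring_mats_iff q'_def row[symmetric])
  finally have "rmat_mult R (rmat_mult R p' A) q' $$ (0, 0) = \<one>"
    using pq(3) by simp
  then have "rmat_mult R (rmat_mult R p' A) q' = rmat_one R 1"
    by (intro ring_mats_eqI[OF rmat_mult_closed[OF pA q'] rmat_one_closed]) (simp add: rmat_one_def)
  then show ?thesis
    using p' q' by blast
qed

text \<open>Sizes zero are included, so that the recursion ends at an empty block, where the
  condition is vacuous.\<close>

lemma diagonal_reduction:
  assumes H: "hermite_ring R" and two: "attains_one R 2 2" and "A \<in> ring_mats R m n"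
  shows "\<exists>P \<in> GL R m. \<exists>Q \<in> GL R n. divisibility_diagonal R m n (rmat_mult R (rmat_mult R P A) Q)"
  using assms(3)
proof (induction m arbitrary: n A)
  case 0
  then show ?case
    using GL_one by (auto simp: divisibility_diagonal_def)
next
  case (Suc m)
  note A = Suc.prems
  show ?case
  proof (cases n)
    case 0
    then show ?thesis
      using GL_one by (auto simp: divisibility_diagonal_def)
  next
    case n: (Suc k)
    have mn: "Suc m \<ge> 1" "n \<ge> 1" and "\<forall>i<Suc m. \<forall>j<n. A $$ (i, j) \<in> carrier R"
      using A n by (simp_all add: ring_mats_iff)
    from hermite_matrix[OF H this] obtain d A' C where d: "d \<in> carrier R"
      "\<forall>i<Suc m. \<forall>j<n. A' i j \<in> carrier R \<and> C i j \<in> carrier R \<and> A $$ (i, j) = d \<otimes> A' i j"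
      "(\<Oplus>i\<in>{..<Suc m}. \<Oplus>j\<in>{..<n}. C i j \<otimes> A' i j) = \<one>"
      by (elim exE conjE) (rule that)
    define B where "B = mat (Suc m) n (\<lambda>(i, j). A' i j)"
    have B: "B \<in> ring_mats R (Suc m) n"
      using d by (simp add: B_def ring_mats_iff)
    have AB: "A = rmat_scale R d B"
      using d by (intro ring_mats_eqI[OF A rmat_scale_closed[OF B d(1)]]) (simp add: B_def rmat_scale_def)
    have "(\<Oplus>i\<in>{..<Suc m}. \<Oplus>j\<in>{..<n}. C i j \<otimes> B $$ (i, j)) = (\<Oplus>i\<in>{..<Suc m}. \<Oplus>j\<in>{..<n}. C i j \<otimes> A' i j)"
      using d(2) by (intro finsum_lessThan_cong finsum_lessThan_closed) (auto simp: B_def)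
    then have one: "(\<Oplus>i\<in>{..<Suc m}. \<Oplus>j\<in>{..<n}. C i j \<otimes> B $$ (i, j)) = \<one>"
      using d(3) by simp
    have "attains_one R (Suc m) n"
      by (rule attains_one_all[OF H two mn])
    from attains_one_mats[OF this B _ one] d(2) obtain p q
      where pq: "p \<in> ring_mats R 1 (Suc m)" "q \<in> ring_mats R n 1"
        "rmat_mult R (rmat_mult R p B) q = rmat_one R 1"
      by blast
    obtain P Q E where PQ: "P \<in> GL R (Suc m)" "Q \<in> GL R n" "E \<in> ring_mats R m k"
      "rmat_mult R (rmat_mult R P B) Q = dsum R (rmat_one R 1) E"
      using split_off_one[OF H B[unfolded n] pq[unfolded n]] n by blast
    obtain P2 Q2 where PQ2: "P2 \<in> GL R m" "Q2 \<in> GL R k"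
      "divisibility_diagonal R m k (rmat_mult R (rmat_mult R P2 E) Q2)"
      using Suc.IH[OF PQ(3)] by blast
    define P1 where "P1 = dsum R (rmat_one R 1) P2"
    define Q1 where "Q1 = dsum R (rmat_one R 1) Q2"
    have P1: "P1 \<in> GL R (Suc m)" and Q1: "Q1 \<in> GL R n"
      using GL_dsum[OF GL_one[of 1] PQ2(1)] GL_dsum[OF GL_one[of 1] PQ2(2)] n
      by (simp_all add: P1_def Q1_def)
    note c = GL_closed[OF PQ(1)] GL_closed[OF PQ(2)] GL_closed[OF P1] GL_closed[OF Q1]
      GL_closed[OF PQ2(1)] GL_closed[OF PQ2(2)]
    note PB = rmat_mult_closed[OF c(1) B] and PA = rmat_mult_closed[OF c(1) A]
    note PBQ = rmat_mult_closed[OF PB c(2)]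
    define D where "D = rmat_mult R (rmat_mult R P2 E) Q2"
    have D: "D \<in> ring_mats R m k"
      unfolding D_def by (rule rmat_mult_closed[OF rmat_mult_closed[OF c(5) PQ(3)] c(6)])
    \<comment> \<open>Rebracketing brings \<open>P A Q\<close> to the inside. There \<open>d\<close>
      is pulled out, and the block matrices \<open>P1\<close> and \<open>Q1\<close> act only on the
      remaining block \<open>E\<close>.\<close>
    have "rmat_mult R (rmat_mult R (rmat_mult R P1 P) A) (rmat_mult R Q Q1)
        = rmat_mult R (rmat_mult R P1 (rmat_mult R (rmat_mult R P A) Q)) Q1"
      unfolding rmat_mult_assoc[OF c(3) c(1) A] rmat_mult_assoc[OF c(3) PA c(2), symmetric]
        rmat_mult_assoc[OF rmat_mult_closed[OF c(3) PA] c(2) c(4)] ..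
    also have "rmat_mult R (rmat_mult R P A) Q = rmat_scale R d (rmat_mult R (rmat_mult R P B) Q)"
      unfolding AB rmat_mult_scale_right[OF c(1) B d(1)] rmat_mult_scale_left[OF PB c(2) d(1)] ..
    also have "rmat_mult R P1 \<dots> = rmat_scale R d (rmat_mult R P1 (rmat_mult R (rmat_mult R P B) Q))"
      by (rule rmat_mult_scale_right[OF c(3) PBQ d(1)])
    also have "rmat_mult R \<dots> Q1 = rmat_scale R d (rmat_mult R (rmat_mult R P1 (rmat_mult R (rmat_mult R P B) Q)) Q1)"
      by (rule rmat_mult_scale_left[OF rmat_mult_closed[OF c(3) PBQ] c(4) d(1)])
    also have "rmat_mult R (rmat_mult R P1 (rmat_mult R (rmat_mult R P B) Q)) Q1 = dsum R (rmat_one R 1) D"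
      unfolding PQ(4) P1_def Q1_def D_def
        dsum_mult[OF rmat_one_closed c(5) rmat_one_closed PQ(3)]
        dsum_mult[OF rmat_one_closed rmat_mult_closed[OF c(5) PQ(3)] rmat_one_closed c(6)]
        rmat_mult_one_left[OF rmat_one_closed] ..
    finally have "divisibility_diagonal R (Suc m) n
        (rmat_mult R (rmat_mult R (rmat_mult R P1 P) A) (rmat_mult R Q Q1))"
      using divisibility_diagonal_Suc[OF D _ d(1)] PQ2(3) n by (simp add: D_def)
    then show ?thesis
      using GL_mult[OF P1 PQ(1)] GL_mult[OF PQ(2) Q1] by blast
  qed
qed

lemma elementary_divisor_ring_if_attains_one:
  assumes "hermite_ring R" "attains_one R 2 2"
  shows "elementary_divisor_ring R"
  unfolding elementary_divisor_ring_def Let_def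
  using diagonal_reduction[OF assms, unfolded divisibility_diagonal_def] by simp

end

section \<open>Rings in which every element is a square\<close>

lemma algebraically_closed_sqrt:
  fixes K (structure)
  assumes "algebraically_closed K" "a \<in> carrier K"
  obtains z where "z \<in> carrier K" "z \<otimes> z = a"
proof -
  interpret algebraically_closed K by (rule assms(1))
  define P where "P = [\<one>, \<zero>, \<ominus> a]"
  have P: "P \<in> carrier (poly_ring K)"
    using assms(2) by (simp add: P_def univ_poly_carrier[symmetric] polynomial_def)
  \<comment> \<open>\<open>P\<close> is the quadratic polynomial with root a square root of
    \<open>a\<close>. It splits, so its roots counted with multiplicity are as many as its degree,
    and there is at least one.\<close>
  have "size (roots P) = 2"
    using roots_over_carrier[OF P] by (simp add: splitted_def P_def)
  then obtain z where "z \<in># roots P"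
    by (metis multiset_nonemptyE size_empty zero_neq_numeral)
  then have "is_root P z"
    using roots_mem_iff_is_root[OF P] by simp
  then have z: "z \<in> carrier K" "eval P z = \<zero>"
    by (simp_all add: is_root_def)
  then have "z \<otimes> z \<oplus> \<ominus> a = \<zero>"
    using assms(2) by (simp add: P_def numeral_2_eq_2)
  then have "z \<otimes> z = a"
    using z assms(2) by (metis m_closed minus_equality a_inv_closed minus_minus a_comm)
  with z show ?thesis
    using that by blast
qed

text \<open>A square root of \<open>h x\<close> in \<open>K\<close> is a root of the monic
  polynomial with coefficients 1, 0 and minus \<open>x\<close>. Integral closedness puts it into the
  image of \<open>h\<close>, and injectivity pulls the equation back.\<close>

lemma all_squares_if_integrally_closed:
  fixes R :: "('a, 'm) ring_scheme" and K :: "('k, 'q) ring_scheme"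
  assumes "is_fraction_field R K h" "integrally_closed_in R K h" "algebraically_closed K"
  shows "all_squares R"
  unfolding all_squares_def
proof
  fix x assume x: "x \<in> carrier R"
  interpret R: domain R
    using assms(1) by (simp add: is_fraction_field_def)
  interpret K: field K
    using assms(1) by (simp add: is_fraction_field_def)
  have h: "h \<in> Ring.ring_hom R K" "inj_on h (carrier R)"
    using assms(1) by (simp_all add: is_fraction_field_def)
  interpret h: ring_hom_ring R K h
    using h(1) by (intro ring_hom_ringI2 R.ring_axioms K.ring_axioms)
  have hx: "h x \<in> carrier K"
    using x by simp
  obtain z where z: "z \<in> carrier K" "z \<otimes>\<^bsub>K\<^esub> z = h x"
    using algebraically_closed_sqrt[OF assms(3) hx] by blast
  define p where "p = [\<one>\<^bsub>R\<^esub>, \<zero>\<^bsub>R\<^esub>, \<ominus>\<^bsub>R\<^esub> x]"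
  have "p \<in> carrier (poly_ring R)"
    using x by (simp add: p_def univ_poly_carrier[symmetric] polynomial_def)
  moreover have "K.eval (map h p) z = \<zero>\<^bsub>K\<^esub>"
    using x z by (simp add: p_def numeral_2_eq_2 K.r_neg)
  ultimately have "integral_element R K h z"
    unfolding integral_element_def using z(1) by (intro conjI bexI[of _ p]) (simp_all add: p_def)
  then obtain y where y: "y \<in> carrier R" "z = h y"
    using assms(2) unfolding integrally_closed_in_def by blast
  have "h (y \<otimes>\<^bsub>R\<^esub> y) = h x"
    using y z(2) by simp
  then have "x = y \<otimes>\<^bsub>R\<^esub> y"
    using inj_onD[OF h(2)] x y(1) by force
  then show "\<exists>y \<in> carrier R. x = y [^]\<^bsub>R\<^esub> (2::nat)"
    using y(1) by (auto simp: numeral_2_eq_2)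
qed

lemma all_squares_if_perfect_char2:
  "perfect_ring_char2 R \<Longrightarrow> all_squares R"
  unfolding perfect_ring_char2_def all_squares_def bij_betw_def by blast

theorem theorem1p17:
  fixes R :: "('a, 'm) ring_scheme"
  assumes "cring R" and "WSU2_ring R"
  shows "WU2_ring R
    \<and> (all_squares R \<longrightarrow> U2_ring R \<and> (SU2_ring R \<longrightarrow> elementary_divisor_ring R))
    \<and> (\<forall>(K :: ('k, 'q) ring_scheme) h.
         is_fraction_field R K h \<and> integrally_closed_in R K h \<and> algebraically_closed K
           \<longrightarrow> all_squares R)
    \<and> (perfect_ring_char2 R \<longrightarrow> all_squares R)"
proof -
  interpret cring R by (rule assms(1))
  have split: "square_splitting R"
    using assms(2) by (rule square_splitting_if_WSU2)
  show ?thesis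
  proof (intro conjI impI allI)
    show "WU2_ring R"
      using split by (rule WU2_if_square_splitting)
    show "U2_ring R" if "all_squares R"
      using split that by (rule U2_if_square_splitting)
    \<comment> \<open>The stronger symmetrization enters through the Hermite property; the splitting
      of squares comes from unimodular matrices alone.\<close>
    show "elementary_divisor_ring R" if "all_squares R" "SU2_ring R"
      using split that(1) hermite_if_SU2[OF that(2)]
      by (intro elementary_divisor_ring_if_attains_one attains_one_2_2)
    show "all_squares R" if "is_fraction_field R K h \<and> integrally_closed_in R K h \<and> algebraically_closed K"
      for K :: "('k, 'q) ring_scheme" and h
      using that all_squares_if_integrally_closed by blast
    show "all_squares R" if "perfect_ring_char2 R"
      using that by (rule all_squares_if_perfect_char2)
  qed
qed

end
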